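(* Let $G$ be a finite group, and let $\mu$ be a shift-invariant Borel probability measure on $G^{\mathbb{N}_0}$ invariant also relative to $\tau_G$. Assume that there exists a normal subgroup $H\vartriangleleft G$ for which $H_{\mu,x}=H$ $\mu$-almost-surely. If $C$ is the maximal size of a proper subgroup of $H$ and $\frac{|G|}{|H|}<\frac{|H|}{C}$, then $h_{(\pi_\mu)_*\mu}(\sigma)=0$.
   Context: $\mathbb{N}_0$ is the set of non-negative integers; $\sigma$ is the left shift on $G^{\mathbb{N}_0}$ and on $(2^G)^{\mathbb{N}_0}$, where $2^G$ is the set of subsets of $G$; $h$ denotes measure-theoretical entropy. $\tau_G:G^{\mathbb{N}_0}\to G^{\mathbb{N}_0}$ is the group multiplication cellular automaton $(\tau_G(x))_i=x_i\cdot x_{i+1}$. Let $\mathcal{B}$ be the Borel $\sigma$-algebra of $G^{\mathbb{N}_0}$ and $\mu_x^{\sigma^{-1}\mathcal{B}}$ the conditional probability of $\mu$ given $\sigma^{-1}\mathcal{B}$ at $x$, viewed as a measure on $G$ through the coordinate at index $0$. For $\mu$ invariant under $\sigma$ and $\tau_G$, it is $\mu$-almost-surely the uniform measure on a right coset of a (necessarily unique) subgroup of $G$, which is denoted $H_{\mu,x}$; this right coset is denoted $\Lambda_{\mu,x}\subseteq G$. The map $\pi_\mu:G^{\mathbb{N}_0}\to(2^G)^{\mathbb{N}_0}$ is the ($\mu$-almost-surely defined) shift-equivariant map with $(\pi_\mu(x))_0=\Lambda_{\mu,x}$, i.e. $(\pi_\mu(x))_i=\Lambda_{\mu,\sigma^i(x)}$.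 *)

theory Defs
  imports "HOL-Probability.Probability" "HOL-Algebra.Coset"
begin

section \<open>One-sided full shifts and invariant measures\<close>

text \<open>
  One-sided sequences over \<open>A\<close>. For countable \<open>A\<close> this product \<open>\<sigma>\<close>-algebra is the Borel
  \<open>\<sigma>\<close>-algebra of the product of the discrete topologies.
\<close>

definition full_shift :: "'a set \<Rightarrow> (nat \<Rightarrow> 'a) measure" where
  "full_shift A = PiM UNIV (\<lambda>_. count_space A)"

definition shift :: "(nat \<Rightarrow> 'a) \<Rightarrow> nat \<Rightarrow> 'a" where
  "shift x = (\<lambda>i. x (Suc i))"

definition mult_ca :: "('a, 'b) monoid_scheme \<Rightarrow> (nat \<Rightarrow> 'a) \<Rightarrow> nat \<Rightarrow> 'a" where
  "mult_ca G x = (\<lambda>i. x i \<otimes>\<^bsub>G\<^esub> x (Suc i))"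

definition invariant_under :: "'x measure \<Rightarrow> ('x \<Rightarrow> 'x) \<Rightarrow> bool" where
  "invariant_under M T \<longleftrightarrow> T \<in> measurable M M \<and> distr M M T = M"


section \<open>Measure-theoretical entropy\<close>

text \<open>
  A finite measurable partition is given by a simple function \<open>X\<close>, its blocks being the fibres
  of \<open>X\<close>. The fibres of \<open>itinerary T X n\<close> are then the blocks of the common refinement of the
  partitions \<open>T\<^sup>-\<^sup>i \<xi>\<close>, \<open>i < n\<close>, where \<open>\<xi>\<close> is the partition of \<open>X\<close>. Values in \<open>nat\<close> suffice
  to label the blocks of every finite partition.
\<close>

definition itinerary :: "('x \<Rightarrow> 'x) \<Rightarrow> ('x \<Rightarrow> nat) \<Rightarrow> nat \<Rightarrow> 'x \<Rightarrow> nat list" where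
  "itinerary T X n = (\<lambda>x. map (\<lambda>i. X ((T ^^ i) x)) [0..<n])"

text \<open>Shannon entropy of the partition into the fibres of \<open>Y\<close>, with the natural logarithm.\<close>

definition partition_entropy :: "'x measure \<Rightarrow> ('x \<Rightarrow> 'y) \<Rightarrow> real" where
  "partition_entropy M Y = prob_space.entropy M (exp 1) (count_space (Y ` space M)) Y"

definition entropy_rate :: "'x measure \<Rightarrow> ('x \<Rightarrow> 'x) \<Rightarrow> ('x \<Rightarrow> nat) \<Rightarrow> real" where
  "entropy_rate M T X = lim (\<lambda>n. partition_entropy M (itinerary T X n) / real n)"

definition measure_entropy :: "'x measure \<Rightarrow> ('x \<Rightarrow> 'x) \<Rightarrow> ereal" where
  "measure_entropy M T = (SUP X\<in>{X. simple_function M X}. ereal (entropy_rate M T X))"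


section \<open>Conditional measures on the first coordinate\<close>

text \<open>
  The conditional probability of \<open>\<mu>\<close> given \<open>\<sigma>\<^sup>-\<^sup>1\<B>\<close> at \<open>x\<close>, viewed as a measure on the finite
  set \<open>carrier G\<close> through the coordinate at index 0: the mass of \<open>g\<close> is a fixed version of
  \<open>\<mu>(y 0 = g | \<sigma>\<^sup>-\<^sup>1\<B>)(x)\<close>.
\<close>

definition cond_measure :: "('a, 'b) monoid_scheme \<Rightarrow> (nat \<Rightarrow> 'a) measure \<Rightarrow> (nat \<Rightarrow> 'a) \<Rightarrow> 'a measure" where
  "cond_measure G \<mu> x = point_measure (carrier G)
     (\<lambda>g. ennreal (real_cond_exp \<mu> (vimage_algebra (space \<mu>) shift \<mu>)
                     (indicator {y \<in> space \<mu>. y 0 = g}) x))"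

definition cond_uniform_on ::
    "('a, 'b) monoid_scheme \<Rightarrow> (nat \<Rightarrow> 'a) measure \<Rightarrow> (nat \<Rightarrow> 'a) \<Rightarrow> 'a set \<Rightarrow> 'a set \<Rightarrow> bool" where
  "cond_uniform_on G \<mu> x K L \<longleftrightarrow> subgroup K G \<and> L \<in> rcosets\<^bsub>G\<^esub> K \<and>
     cond_measure G \<mu> x = uniform_measure (count_space (carrier G)) L"

text \<open>
  The subgroup \<open>H\<^bsub>\<mu>,x\<^esub>\<close> and its right coset \<open>\<Lambda>\<^bsub>\<mu>,x\<^esub>\<close>. On the null set of points \<open>x\<close> where the
  conditional measure is not uniform on a right coset, both are set to \<open>{}\<close>; this is not a
  subgroup, so \<open>cond_subgroup G \<mu> x = H\<close> for a subgroup \<open>H\<close> implies that \<open>x\<close> is not such a point,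
  and \<open>cond_coset\<close> always has values in \<open>Pow (carrier G)\<close>.
\<close>

definition cond_subgroup :: "('a, 'b) monoid_scheme \<Rightarrow> (nat \<Rightarrow> 'a) measure \<Rightarrow> (nat \<Rightarrow> 'a) \<Rightarrow> 'a set" where
  "cond_subgroup G \<mu> x =
     (if \<exists>K L. cond_uniform_on G \<mu> x K L then THE K. \<exists>L. cond_uniform_on G \<mu> x K L else {})"

definition cond_coset :: "('a, 'b) monoid_scheme \<Rightarrow> (nat \<Rightarrow> 'a) measure \<Rightarrow> (nat \<Rightarrow> 'a) \<Rightarrow> 'a set" where
  "cond_coset G \<mu> x =
     (if \<exists>K L. cond_uniform_on G \<mu> x K L then THE L. \<exists>K. cond_uniform_on G \<mu> x K L else {})"

definition coset_map :: "('a, 'b) monoid_scheme \<Rightarrow> (nat \<Rightarrow> 'a) measure \<Rightarrow> (nat \<Rightarrow> 'a) \<Rightarrow> nat \<Rightarrow> 'a set" where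
  "coset_map G \<mu> x = (\<lambda>i. cond_coset G \<mu> ((shift ^^ i) x))"

end

theory Submission
  imports Defs
begin

text \<open>
  Almost surely \<open>\<Lambda>\<^bsub>\<mu>,x\<^esub> = H x\<^sub>0\<close>, and \<open>\<mu>\<close> is invariant under \<open>L\<^sub>h: x\<^sub>0 \<mapsto> h x\<^sub>0\<close> for \<open>h \<in> H\<close>, so the shift has
  entropy \<open>log |H|\<close>. The key fact is that a function \<open>P\<close> invariant under \<open>\<tau>\<^sub>G\<close> is invariant under \<open>L\<^sub>h\<close>.
  The first \<open>n\<close> symbols of a row and the first \<open>n\<close> symbols of a column of the space-time diagram
  determine each other, so the values of \<open>P\<close> along the row, being constant along columns, take away
  nothing from the entropy \<open>log |H|\<close> per symbol of the row; hence \<open>x\<^sub>0\<close> and \<open>P\<close> are independent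
  given \<open>\<sigma>\<^sup>-\<^sup>1\<B>\<close>, and \<open>P\<close> is \<open>\<sigma>\<^sup>-\<^sup>1\<B>\<close>-measurable.

  Now extend \<open>x\<close> to the left. The coset \<open>H x\<^bsub>-1\<^esub>\<close> is a function \<open>F\<close> of \<open>x\<close>, and for \<open>h \<in> H\<close> the ratio
  \<open>F(L\<^sub>h x) F(x)\<^sup>-\<^sup>1 \<in> G/H\<close> is invariant under \<open>\<tau>\<^sub>G\<close>, hence unchanged when \<open>x\<close> is replaced by
  \<open>L\<^sub>k x\<close>. So it is a homomorphism in \<open>h\<close>, with kernel of index at most \<open>|G/H|\<close> in \<open>H\<close>. By the
  hypothesis on \<open>C\<close> the kernel is \<open>H\<close>, that is, \<open>F\<close> does not depend on \<open>x\<^sub>0\<close>. Inductively, none of the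
  cosets \<open>H x\<^bsub>-k\<^esub>\<close> depends on \<open>x\<^sub>0\<close>. Hence conditioning on all the cosets \<open>H x\<^sub>i\<close> leaves the entropy
  \<open>log |H|\<close> of the shift unchanged, and the coset process has entropy zero.
\<close>

section \<open>Entropy of finite-valued random variables\<close>

context prob_space
begin

text \<open>Minus the logarithm of this is the information function of the partition, whose integral
  is the entropy. It reduces entropy inequalities to almost sure ones.\<close>

definition atom_prob :: "('a \<Rightarrow> 'c) \<Rightarrow> 'a \<Rightarrow> real" where
  "atom_prob U x = prob {y \<in> space M. U y = U x}"

lemma sets_simple_eq [measurable]: "simple_function M U \<Longrightarrow> {y \<in> space M. U y = u} \<in> sets M"
  using measurable_sets[OF measurable_simple_function[of M U], of "{u}"]
  by (simp add: vimage_def Int_def conj_commute)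

lemma sets_simple_pred: "simple_function M U \<Longrightarrow> {y \<in> space M. P (U y)} \<in> sets M"
  using measurable_sets[OF measurable_simple_function[of M U], of "Collect P"]
  by (simp add: vimage_def Int_def conj_commute)

lemma vimage_singleton_space: "U -` {u} \<inter> space M = {y \<in> space M. U y = u}"
  by auto

lemma borel_measurable_comp_simple: "simple_function M U \<Longrightarrow> (\<lambda>x. f (U x) :: real) \<in> borel_measurable M"
  by (rule borel_measurable_simple_function[OF simple_function_compose1])

lemma integrable_comp_simple:
  assumes "simple_function M U"
  shows "integrable M (\<lambda>x. f (U x) :: real)"
proof -
  have "finite ((\<lambda>u. norm (f u)) ` U ` space M)"
    using simple_functionD(1)[OF assms] by simp
  then have "norm (f (U x)) \<le> Max ((\<lambda>u. norm (f u)) ` U ` space M)" if "x \<in> space M" for x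
    using that by (intro Max_ge) auto
  then have "AE x in M. norm (f (U x)) \<le> Max ((\<lambda>u. norm (f u)) ` U ` space M)"
    by (rule AE_I2)
  then show ?thesis
    by (rule integrable_const_bound) (rule borel_measurable_comp_simple[OF assms])
qed

lemma integral_comp_simple:
  assumes U: "simple_function M U"
  shows "(\<integral>x. f (U x) \<partial>M) = (\<Sum>u\<in>U ` space M. f u * prob {y \<in> space M. U y = u} :: real)"
proof -
  have fin: "finite (U ` space M)"
    using simple_functionD(1)[OF U] .
  have "(\<integral>x. f (U x) \<partial>M) = (\<integral>x. (\<Sum>u\<in>U ` space M. f u * indicator {y \<in> space M. U y = u} x) \<partial>M)"
  proof (rule Bochner_Integration.integral_cong[OF refl])
    fix x assume x: "x \<in> space M"
    have "(\<Sum>u\<in>U ` space M. f u * indicator {y \<in> space M. U y = u} x)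
      = (\<Sum>u\<in>U ` space M. if u = U x then f u else 0)"
      using x by (intro sum.cong) (auto simp: indicator_def)
    then show "f (U x) = (\<Sum>u\<in>U ` space M. f u * indicator {y \<in> space M. U y = u} x)"
      using x fin by simp
  qed
  also have "\<dots> = (\<Sum>u\<in>U ` space M. f u * prob {y \<in> space M. U y = u})"
    using U by (subst Bochner_Integration.integral_sum)
      (auto intro!: sum.cong integrable_mult_right simp: sets_simple_eq less_top[symmetric] emeasure_eq_measure)
  finally show ?thesis .
qed

lemma partition_entropy_sum:
  assumes U: "simple_function M U"
  shows "partition_entropy M U
    = - (\<Sum>u\<in>U ` space M. prob {y \<in> space M. U y = u} * ln (prob {y \<in> space M. U y = u}))"
proof -
  interpret information_space M "exp 1"
    by unfold_locales simp
  show ?thesis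
    unfolding partition_entropy_def
    using entropy_simple_distributed[OF simple_distributedI[OF U measure_nonneg refl]]
    by (simp add: log_def vimage_singleton_space)
qed

lemma partition_entropy_integral:
  assumes U: "simple_function M U"
  shows "partition_entropy M U = (\<integral>x. - ln (atom_prob U x) \<partial>M)"
  using integral_comp_simple[OF U, of "\<lambda>u. - ln (prob {y \<in> space M. U y = u})"]
  by (simp only: partition_entropy_sum[OF U] atom_prob_def sum_negf mult_minus_left mult_minus_right mult.commute)

lemma integrable_ln_atom_prob:
  assumes "simple_function M U"
  shows "integrable M (\<lambda>x. ln (atom_prob U x))"
  unfolding atom_prob_def
  using integrable_comp_simple[OF assms, of "\<lambda>u. ln (prob {y \<in> space M. U y = u})"] .

lemma AE_atom_prob_pos:
  assumes U: "simple_function M U"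
  shows "AE x in M. 0 < atom_prob U x"
proof -
  have "AE x in M. \<forall>u\<in>U ` space M. prob {y \<in> space M. U y = u} = 0 \<longrightarrow> U x \<noteq> u"
  proof (rule AE_finite_allI[OF simple_functionD(1)[OF U]])
    fix u assume "u \<in> U ` space M"
    show "AE x in M. prob {y \<in> space M. U y = u} = 0 \<longrightarrow> U x \<noteq> u"
    proof (cases "prob {y \<in> space M. U y = u} = 0")
      case True
      then have "AE x in M. x \<notin> {y \<in> space M. U y = u}"
        using prob_eq_0[OF sets_simple_eq[OF U]] by simp
      then show ?thesis using AE_space by eventually_elim auto
    qed simp
  qed
  then show ?thesis
    using AE_space by eventually_elim (auto simp: atom_prob_def zero_less_measure_iff)
qed

text \<open>Each atom of \<open>U\<close> of positive probability lies, up to a null set, in one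
  atom of \<open>V\<close>, so the information function of \<open>V\<close> is almost surely the
  smaller one.\<close>

lemma partition_entropy_mono:
  assumes U: "simple_function M U" and V: "simple_function M V" and VU: "AE x in M. V x = f (U x)"
  shows "partition_entropy M V \<le> partition_entropy M U"
proof -
  have "AE x in M. ln (atom_prob U x) \<le> ln (atom_prob V x)"
    using AE_atom_prob_pos[OF U] VU
  proof eventually_elim
    case (elim x)
    have "prob {y \<in> space M. U y = U x} \<le> prob {y \<in> space M. V y = V x}"
    proof (rule finite_measure_mono_AE[OF _ sets_simple_eq[OF V]])
      show "AE y in M. y \<in> {y \<in> space M. U y = U x} \<longrightarrow> y \<in> {y \<in> space M. V y = V x}"
        using VU by eventually_elim (simp add: elim(2))
    qed
    then show ?case
      using elim(1) by (simp add: atom_prob_def)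
  qed
  then show ?thesis
    unfolding partition_entropy_integral[OF U] partition_entropy_integral[OF V]
    by (intro integral_mono_AE integrable_minus integrable_ln_atom_prob U V) auto
qed

lemma partition_entropy_mono_pointwise:
  assumes U: "simple_function M U" and V: "simple_function M V"
    and VU: "\<And>x y. x \<in> space M \<Longrightarrow> y \<in> space M \<Longrightarrow> U x = U y \<Longrightarrow> V x = V y"
  shows "partition_entropy M V \<le> partition_entropy M U"
\<comment> \<open>A choice of representative in each fibre of \<open>U\<close> turns the condition
  on pairs of points into a function from labels to labels.\<close>
proof (rule partition_entropy_mono[OF U V, where f="\<lambda>u. V (SOME y. y \<in> space M \<and> U y = u)"])
  show "AE x in M. V x = V (SOME y. y \<in> space M \<and> U y = U x)"
  proof (rule AE_I2)
    fix x assume x: "x \<in> space M"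
    have "(SOME y. y \<in> space M \<and> U y = U x) \<in> space M \<and> U (SOME y. y \<in> space M \<and> U y = U x) = U x"
      by (rule someI[of _ x]) (use x in simp)
    then show "V x = V (SOME y. y \<in> space M \<and> U y = U x)"
      using x by (metis VU)
  qed
qed

lemma partition_entropy_eq_pointwise:
  assumes "simple_function M U" "simple_function M V"
    and "\<And>x y. x \<in> space M \<Longrightarrow> y \<in> space M \<Longrightarrow> U x = U y \<longleftrightarrow> V x = V y"
  shows "partition_entropy M U = partition_entropy M V"
  using assms by (intro antisym partition_entropy_mono_pointwise) blast+

lemma partition_entropy_cong_AE:
  assumes "simple_function M U" "simple_function M V" "AE x in M. U x = V x"
  shows "partition_entropy M U = partition_entropy M V"
proof (rule antisym)
  show "partition_entropy M V \<le> partition_entropy M U"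
    using assms(3) by (intro partition_entropy_mono[OF assms(1,2), where f="\<lambda>u. u"]) (simp add: eq_commute)
  show "partition_entropy M U \<le> partition_entropy M V"
    using assms(3) by (rule partition_entropy_mono[OF assms(2,1), where f="\<lambda>u. u"])
qed

lemma partition_entropy_nonneg:
  assumes U: "simple_function M U"
  shows "0 \<le> partition_entropy M U"
proof -
  have "AE x in M. 0 \<le> - ln (atom_prob U x)"
    using AE_atom_prob_pos[OF U] by eventually_elim (simp add: atom_prob_def)
  then show ?thesis
    unfolding partition_entropy_integral[OF U] by (rule integral_nonneg_AE)
qed

lemma partition_entropy_le_ln_card:
  assumes U: "simple_function M U" and S: "U ` space M \<subseteq> S" "finite S"
  shows "partition_entropy M U \<le> ln (card S)"
proof -
  interpret information_space M "exp 1"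
    by unfold_locales simp
  have "partition_entropy M U \<le> ln (card (U ` space M))"
    unfolding partition_entropy_def
    using entropy_le_card[OF simple_distributedI[OF U measure_nonneg refl]] by (simp add: log_def)
  also have "\<dots> \<le> ln (card S)"
  proof -
    have "0 < card (U ` space M)"
      using simple_functionD(1)[OF U] not_empty by (simp add: card_gt_0_iff)
    then show ?thesis
      using card_mono[OF S(2,1)] by simp
  qed
  finally show ?thesis .
qed

text \<open>The difference of the two sides is the conditional mutual information of
  \<open>U\<close> and \<open>V\<close> given \<open>W\<close>, which is nonnegative.\<close>

lemma partition_entropy_submodular:
  assumes U: "simple_function M U" and V: "simple_function M V" and W: "simple_function M W"
  shows "partition_entropy M (\<lambda>x. (U x, V x, W x)) + partition_entropy M W
    \<le> partition_entropy M (\<lambda>x. (U x, W x)) + partition_entropy M (\<lambda>x. (V x, W x))"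
proof -
  interpret information_space M "exp 1"
    by unfold_locales simp
  note UW = simple_function_Pair[OF U W] and VW = simple_function_Pair[OF V W]
  note UVW = simple_function_Pair[OF U VW]
  let ?p = "\<lambda>u v w. prob {y \<in> space M. (U y, V y, W y) = (u, v, w)}"
  let ?q = "\<lambda>u w. prob {y \<in> space M. (U y, W y) = (u, w)}"
  let ?r = "\<lambda>v w. prob {y \<in> space M. (V y, W y) = (v, w)}"
  let ?s = "\<lambda>w. prob {y \<in> space M. W y = w}"
  let ?f = "\<lambda>(u, v, w). ln (?p u v w / (?q u w * (?r v w / ?s w)))"
  let ?I = "conditional_mutual_information (exp 1) (count_space (U ` space M))
    (count_space (V ` space M)) (count_space (W ` space M)) U V W"
  have "0 \<le> ?I"
    by (rule conditional_mutual_information_nonneg[OF U V W])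
  also have "?I = (\<Sum>t\<in>(\<lambda>x. (U x, V x, W x)) ` space M. ?f t
      * prob {y \<in> space M. (U y, V y, W y) = t})"
    by (subst conditional_mutual_information_eq[OF simple_distributedI[OF W measure_nonneg refl]
          simple_distributedI[OF VW measure_nonneg refl] simple_distributedI[OF UW measure_nonneg refl]
          simple_distributedI[OF UVW measure_nonneg refl]])
       (rule sum.cong, rule refl, simp only: log_def vimage_singleton_space split: prod.split, simp)
  also have "\<dots> = (\<integral>x. ?f (U x, V x, W x) \<partial>M)"
    using integral_comp_simple[OF UVW, of ?f] by simp
  also have "\<dots> = (\<integral>x. (ln (atom_prob (\<lambda>x. (U x, V x, W x)) x) + ln (atom_prob W x))
      - (ln (atom_prob (\<lambda>x. (U x, W x)) x) + ln (atom_prob (\<lambda>x. (V x, W x)) x)) \<partial>M)"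
  proof (rule integral_cong_AE)
    \<comment> \<open>Almost surely all atoms involved have positive probability, so the logarithm
      of the quotient splits.\<close>
    show "AE x in M. ?f (U x, V x, W x) =
      (ln (atom_prob (\<lambda>x. (U x, V x, W x)) x) + ln (atom_prob W x))
      - (ln (atom_prob (\<lambda>x. (U x, W x)) x) + ln (atom_prob (\<lambda>x. (V x, W x)) x))"
      using AE_atom_prob_pos[OF U] AE_atom_prob_pos[OF V] AE_atom_prob_pos[OF W]
        AE_atom_prob_pos[OF UW] AE_atom_prob_pos[OF VW] AE_atom_prob_pos[OF UVW]
      by eventually_elim (simp add: atom_prob_def ln_mult ln_div)
    show "(\<lambda>x. ?f (U x, V x, W x)) \<in> borel_measurable M"
      using borel_measurable_comp_simple[OF UVW, of ?f] .
  qed (intro borel_measurable_diff borel_measurable_add borel_measurable_integrable[OF integrable_ln_atom_prob] U V W UW VW UVW)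
  also have "\<dots> = partition_entropy M (\<lambda>x. (U x, W x)) + partition_entropy M (\<lambda>x. (V x, W x))
      - partition_entropy M (\<lambda>x. (U x, V x, W x)) - partition_entropy M W"
    by (simp add: partition_entropy_integral integrable_ln_atom_prob U V W UW VW UVW)
  finally show ?thesis by simp
qed

lemma partition_entropy_distr:
  assumes T: "T \<in> measurable M N" and U: "simple_function N U"
  shows "partition_entropy (distr M N T) U = partition_entropy M (\<lambda>x. U (T x))"
proof -
  interpret N: prob_space "distr M N T"
    by (rule prob_space_distr[OF T])
  have U': "simple_function (distr M N T) U"
    using U by (simp add: simple_function_def)
  have UT: "simple_function M (\<lambda>x. U (T x))"
    using simple_function_comp[OF T U] .
  have "atom_prob (\<lambda>x. U (T x)) x = N.atom_prob U (T x)" if "x \<in> space M" for x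
  proof -
    have "N.atom_prob U (T x) = prob (T -` {y \<in> space N. U y = U (T x)} \<inter> space M)"
      using N.sets_simple_eq[OF U', of "U (T x)"] by (simp add: N.atom_prob_def measure_distr[OF T])
    also have "T -` {y \<in> space N. U y = U (T x)} \<inter> space M = {y \<in> space M. U (T y) = U (T x)}"
      using measurable_space[OF T] by auto
    finally show ?thesis
      by (simp add: atom_prob_def)
  qed
  then have "partition_entropy M (\<lambda>x. U (T x)) = (\<integral>x. - ln (N.atom_prob U (T x)) \<partial>M)"
    unfolding partition_entropy_integral[OF UT] by (intro Bochner_Integration.integral_cong) auto
  also have "\<dots> = (\<integral>x. - ln (N.atom_prob U x) \<partial>distr M N T)"
    using borel_measurable_integrable[OF N.integrable_ln_atom_prob[OF U']]
    by (intro integral_distr[symmetric, OF T]) simp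
  finally show ?thesis
    using N.partition_entropy_integral[OF U'] by simp
qed

lemma partition_entropy_comp:
  assumes "T \<in> measurable M M" "distr M M T = M" "simple_function M U"
  shows "partition_entropy M (\<lambda>x. U (T x)) = partition_entropy M U"
  using partition_entropy_distr[OF assms(1,3)] assms(2) by simp

section \<open>Conditional entropy, as a difference of two entropies\<close>

definition cond_ent :: "('a \<Rightarrow> 'c) \<Rightarrow> ('a \<Rightarrow> 'd) \<Rightarrow> real" where
  "cond_ent U W = partition_entropy M (\<lambda>x. (U x, W x)) - partition_entropy M W"

lemma cond_ent_nonneg: "simple_function M U \<Longrightarrow> simple_function M W \<Longrightarrow> 0 \<le> cond_ent U W"
  unfolding cond_ent_def
  using partition_entropy_mono_pointwise[of "\<lambda>x. (U x, W x)" W] by simp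

lemma cond_ent_comp:
  assumes "T \<in> measurable M M" "distr M M T = M" "simple_function M U" "simple_function M W"
  shows "cond_ent (\<lambda>x. U (T x)) (\<lambda>x. W (T x)) = cond_ent U W"
  unfolding cond_ent_def
  using partition_entropy_comp[OF assms(1,2) simple_function_Pair[OF assms(3,4)]]
    partition_entropy_comp[OF assms(1,2,4)] by simp

lemma cond_ent_cong_AE:
  assumes "simple_function M U" "simple_function M U'" "simple_function M W" "simple_function M W'"
    and "AE x in M. U x = U' x" "AE x in M. W x = W' x"
  shows "cond_ent U W = cond_ent U' W'"
proof -
  have "AE x in M. (U x, W x) = (U' x, W' x)"
    using assms(5,6) by eventually_elim simp
  then show ?thesis
    unfolding cond_ent_def
    using partition_entropy_cong_AE[OF simple_function_Pair[OF assms(1,3)] simple_function_Pair[OF assms(2,4)]]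
      partition_entropy_cong_AE[OF assms(3,4,6)] by simp
qed

lemma cond_ent_eq_pointwise:
  assumes "simple_function M U" "simple_function M U'" "simple_function M W"
    and "\<And>x y. x \<in> space M \<Longrightarrow> y \<in> space M \<Longrightarrow> U x = U y \<longleftrightarrow> U' x = U' y"
  shows "cond_ent U W = cond_ent U' W"
  unfolding cond_ent_def
  using partition_entropy_eq_pointwise[OF simple_function_Pair[OF assms(1,3)] simple_function_Pair[OF assms(2,3)]]
    assms(4) by auto

text \<open>\<open>S\<close> may be any labelling of the common refinement of \<open>U\<close> and
  \<open>V\<close>; with a word for \<open>S\<close>, this peels off the first letter.\<close>

lemma cond_ent_chain:
  assumes U: "simple_function M U" and V: "simple_function M V" and W: "simple_function M W"
    and S: "simple_function M S"
    and "\<And>x y. x \<in> space M \<Longrightarrow> y \<in> space M \<Longrightarrow> S x = S y \<longleftrightarrow> U x = U y \<and> V x = V y"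
  shows "cond_ent S W = cond_ent V W + cond_ent U (\<lambda>x. (V x, W x))"
proof -
  have "partition_entropy M (\<lambda>x. (S x, W x)) = partition_entropy M (\<lambda>x. (U x, V x, W x))"
    by (intro partition_entropy_eq_pointwise simple_function_Pair U V W S) (metis assms(5) prod.inject)
  then show ?thesis
    by (simp add: cond_ent_def)
qed

text \<open>When \<open>W\<close> determines \<open>V\<close>, adjoining \<open>V\<close> to
  \<open>W\<close> leaves the partition unchanged, and submodularity for \<open>U\<close>,
  \<open>W\<close>, \<open>V\<close> becomes the claim.\<close>

lemma cond_ent_antimono:
  assumes U: "simple_function M U" and V: "simple_function M V" and W: "simple_function M W"
    and VW: "\<And>x y. x \<in> space M \<Longrightarrow> y \<in> space M \<Longrightarrow> W x = W y \<Longrightarrow> V x = V y"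
  shows "cond_ent U W \<le> cond_ent U V"
proof -
  have "partition_entropy M (\<lambda>x. (U x, W x, V x)) = partition_entropy M (\<lambda>x. (U x, W x))"
    by (intro partition_entropy_eq_pointwise simple_function_Pair U V W) (metis VW prod.inject)
  moreover have "partition_entropy M (\<lambda>x. (W x, V x)) = partition_entropy M W"
    by (intro partition_entropy_eq_pointwise simple_function_Pair V W) (metis VW prod.inject)
  ultimately show ?thesis
    using partition_entropy_submodular[OF U W V] by (simp add: cond_ent_def)
qed

lemma cond_ent_le_entropy:
  assumes U: "simple_function M U" and W: "simple_function M W"
  shows "cond_ent U W \<le> partition_entropy M U"
proof -
  have "cond_ent U W \<le> cond_ent U (\<lambda>_. ())"
    by (rule cond_ent_antimono[OF U _ W]) auto
  also have "\<dots> \<le> partition_entropy M (\<lambda>x. (U x, ()))"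
    using partition_entropy_nonneg[of "\<lambda>_. ()"] by (simp add: cond_ent_def)
  also have "\<dots> = partition_entropy M U"
    using U by (intro partition_entropy_eq_pointwise simple_function_Pair) auto
  finally show ?thesis .
qed

lemma cond_ent_le_chain:
  assumes U: "simple_function M U" and V: "simple_function M V" and W: "simple_function M W"
    and S: "simple_function M S"
    and "\<And>x y. x \<in> space M \<Longrightarrow> y \<in> space M \<Longrightarrow> U x = U y \<Longrightarrow> V x = V y \<Longrightarrow> S x = S y"
  shows "cond_ent S W \<le> cond_ent V W + cond_ent U (\<lambda>x. (V x, W x))"
proof -
  have "partition_entropy M (\<lambda>x. (S x, W x)) \<le> partition_entropy M (\<lambda>x. (U x, V x, W x))"
    by (intro partition_entropy_mono_pointwise simple_function_Pair U V W S) (metis assms(5) prod.inject)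
  then show ?thesis
    by (simp add: cond_ent_def)
qed

lemma cond_ent_subadd:
  assumes U: "simple_function M U" and V: "simple_function M V" and W: "simple_function M W"
    and S: "simple_function M S"
    and "\<And>x y. x \<in> space M \<Longrightarrow> y \<in> space M \<Longrightarrow> U x = U y \<Longrightarrow> V x = V y \<Longrightarrow> S x = S y"
  shows "cond_ent S W \<le> cond_ent U W + cond_ent V W"
proof -
  have "cond_ent U (\<lambda>x. (V x, W x)) \<le> cond_ent U W"
    by (rule cond_ent_antimono[OF U W simple_function_Pair[OF V W]]) simp
  moreover have "cond_ent S W \<le> cond_ent V W + cond_ent U (\<lambda>x. (V x, W x))"
    by (rule cond_ent_le_chain[OF U V W S]) (rule assms(5))
  ultimately show ?thesis by linarith
qed

lemma cond_ent_integral: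
  assumes U: "simple_function M U" and W: "simple_function M W"
  shows "cond_ent U W = (\<integral>x. ln (atom_prob W x) - ln (atom_prob (\<lambda>x. (U x, W x)) x) \<partial>M)"
  unfolding cond_ent_def partition_entropy_integral[OF W]
    partition_entropy_integral[OF simple_function_Pair[OF U W]]
  by (simp add: integrable_ln_atom_prob U W)

text \<open>
  \<open>T h\<close> permutes the values of \<open>U\<close> within each atom of \<open>W\<close>, so an atom of \<open>W\<close> is split by \<open>U\<close>
  into pieces at most \<open>1 / card H\<close> as large.
\<close>

lemma cond_ent_ge_ln_card:
  assumes U: "simple_function M U" and W: "simple_function M W"
    and H: "finite H" "H \<noteq> {}"
    and T: "\<And>h. h \<in> H \<Longrightarrow> T h \<in> measurable M M" "\<And>h. h \<in> H \<Longrightarrow> distr M M (T h) = M"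
    and WT: "\<And>h. h \<in> H \<Longrightarrow> AE x in M. W (T h x) = W x"
    and UT: "\<And>h x. h \<in> H \<Longrightarrow> x \<in> space M \<Longrightarrow> U (T h x) = f h (U x)"
    and f: "\<And>x. x \<in> space M \<Longrightarrow> inj_on (\<lambda>h. f h (U x)) H"
  shows "ln (card H) \<le> cond_ent U W"
proof -
  let ?UW = "\<lambda>x. (U x, W x)"
  note UW = simple_function_Pair[OF U W]
  have card: "real (card H) * atom_prob ?UW x \<le> atom_prob W x" if x: "x \<in> space M" for x
  proof -
    \<comment> \<open>Up to a null set, \<open>T h\<close> carries the atom of \<open>(U, W)\<close>
      at \<open>x\<close> into \<open>?A h\<close>. By injectivity of \<open>f\<close> in
      \<open>h\<close>, these \<open>card H\<close> sets are disjoint parts of one atom of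
      \<open>W\<close>.\<close>
    let ?A = "\<lambda>h. {y \<in> space M. (U y, W y) = (f h (U x), W x)}"
    have "atom_prob ?UW x \<le> prob (?A h)" if h: "h \<in> H" for h
    proof -
      have "atom_prob ?UW x \<le> prob (T h -` ?A h \<inter> space M)"
        unfolding atom_prob_def
      proof (rule finite_measure_mono_AE)
        show "AE y in M. y \<in> {y \<in> space M. (U y, W y) = (U x, W x)} \<longrightarrow> y \<in> T h -` ?A h \<inter> space M"
          using WT[OF h] AE_space
        proof eventually_elim
          case (elim y)
          then show ?case
            using UT[OF h, of y] measurable_space[OF T(1)[OF h], of y] by auto
        qed
        show "T h -` ?A h \<inter> space M \<in> sets M"
          using measurable_sets[OF T(1)[OF h] sets_simple_eq[OF UW]] .
      qed
      also have "\<dots> = measure (distr M M (T h)) (?A h)"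
        by (rule measure_distr[symmetric, OF T(1)[OF h]]) (simp only: sets_simple_eq[OF UW])
      finally show ?thesis
        using T(2)[OF h] by simp
    qed
    then have "real (card H) * atom_prob ?UW x \<le> (\<Sum>h\<in>H. prob (?A h))"
      using sum_bounded_below[of H "atom_prob ?UW x" "\<lambda>h. prob (?A h)"] by simp
    also have "\<dots> = prob (\<Union>h\<in>H. ?A h)"
    proof (rule finite_measure_finite_Union[symmetric, OF H(1)])
      show "?A ` H \<subseteq> sets M"
        using sets_simple_eq[OF UW] by blast
      show "disjoint_family_on ?A H"
        using f[OF x] by (auto simp: disjoint_family_on_def inj_on_def)
    qed
    also have "\<dots> \<le> atom_prob W x"
      unfolding atom_prob_def by (intro finite_measure_mono sets_simple_eq[OF W]) auto
    finally show ?thesis .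
  qed
  have pos: "0 < card H"
    using H by (simp add: card_gt_0_iff)
  have "AE x in M. ln (card H) \<le> ln (atom_prob W x) - ln (atom_prob ?UW x)"
    using AE_atom_prob_pos[OF UW] AE_space AE_atom_prob_pos[OF W]
  proof eventually_elim
    case (elim x)
    have "ln (card H) + ln (atom_prob ?UW x) = ln (real (card H) * atom_prob ?UW x)"
      using elim pos by (simp add: ln_mult)
    also have "\<dots> \<le> ln (atom_prob W x)"
      using card[OF elim(2)] elim(1,3) pos by (subst ln_le_cancel_iff) auto
    finally show ?case by simp
  qed
  then have "(\<integral>x. ln (card H) \<partial>M) \<le> cond_ent U W"
    unfolding cond_ent_integral[OF U W]
    by (intro integral_mono_AE Bochner_Integration.integrable_diff integrable_ln_atom_prob UW W) auto
  then show ?thesis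
    by (simp add: prob_space)
qed

section \<open>Vanishing and small conditional entropy\<close>

lemma cond_ent_eq_0:
  assumes "simple_function M U" "simple_function M W"
    and "\<And>x y. x \<in> space M \<Longrightarrow> y \<in> space M \<Longrightarrow> W x = W y \<Longrightarrow> U x = U y"
  shows "cond_ent U W = 0"
proof -
  have "partition_entropy M (\<lambda>x. (U x, W x)) \<le> partition_entropy M W"
    by (intro partition_entropy_mono_pointwise simple_function_Pair assms(1,2)) (metis assms(3) prod.inject)
  then show ?thesis
    using cond_ent_nonneg[OF assms(1,2)] by (simp add: cond_ent_def)
qed

text \<open>A weak form of Fano's inequality: guess the conditionally most likely value. The actual
  value is at most as likely, and \<open>- ln t\<close> is at least \<open>1 - t\<close>, so the
  error probability is at most the conditional entropy.\<close>

lemma exists_estimator: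
  assumes U: "simple_function M U" and W: "simple_function M W"
  shows "\<exists>g. prob {x \<in> space M. U x \<noteq> g (W x)} \<le> cond_ent U W"
proof -
  let ?UW = "\<lambda>x. (U x, W x)"
  note UW = simple_function_Pair[OF U W]
  let ?p = "\<lambda>u w. prob {y \<in> space M. (U y, W y) = (u, w)}"
  have "\<exists>g. \<forall>w. is_arg_max (\<lambda>u. ?p u w) (\<lambda>u. u \<in> U ` space M) (g w)"
  proof (intro choice allI)
    fix w
    have fin: "finite ((\<lambda>u. ?p u w) ` U ` space M)" and ne: "(\<lambda>u. ?p u w) ` U ` space M \<noteq> {}"
      using simple_functionD(1)[OF U] not_empty by auto
    then obtain u where "u \<in> U ` space M" "?p u w = Max ((\<lambda>u. ?p u w) ` U ` space M)"
      using Max_in[OF fin ne] by (metis (no_types, lifting) imageE)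
    then have "is_arg_max (\<lambda>u. ?p u w) (\<lambda>u. u \<in> U ` space M) u"
      using fin by (auto simp: is_arg_max_linorder)
    then show "\<exists>u. is_arg_max (\<lambda>u. ?p u w) (\<lambda>u. u \<in> U ` space M) u" ..
  qed
  then obtain g where g: "\<And>w u. u \<in> U ` space M \<Longrightarrow> ?p u w \<le> ?p (g w) w"
    by (auto simp: is_arg_max_linorder)
  \<comment> \<open>Conditional probability that the guess is right, given the label
    \<open>w\<close>; division by zero makes it 0 for labels of probability 0.\<close>
  let ?q = "\<lambda>w. ?p (g w) w / prob {y \<in> space M. W y = w}"
  have meas: "{x \<in> space M. U x = g (W x)} \<in> sets M"
    using sets_simple_pred[OF UW, of "\<lambda>(u, w). u = g w"] by simp
  have "(\<integral>x. ?q (W x) \<partial>M) = (\<Sum>w\<in>W ` space M. ?q w * prob {y \<in> space M. W y = w})"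
    by (rule integral_comp_simple[OF W])
  also have "\<dots> \<le> (\<Sum>w\<in>W ` space M. ?p (g w) w)"
    by (intro sum_mono) auto
  also have "\<dots> = prob (\<Union>w\<in>W ` space M. {y \<in> space M. (U y, W y) = (g w, w)})"
  proof (rule finite_measure_finite_Union[symmetric, OF simple_functionD(1)[OF W]])
    show "(\<lambda>w. {y \<in> space M. (U y, W y) = (g w, w)}) ` W ` space M \<subseteq> sets M"
      using sets_simple_eq[OF UW] by blast
  qed (auto simp: disjoint_family_on_def)
  also have "(\<Union>w\<in>W ` space M. {y \<in> space M. (U y, W y) = (g w, w)}) = {x \<in> space M. U x = g (W x)}"
    by auto
  finally have q: "(\<integral>x. ?q (W x) \<partial>M) \<le> prob {x \<in> space M. U x = g (W x)}" .
  have "AE x in M. 1 - ?q (W x) \<le> ln (atom_prob W x) - ln (atom_prob ?UW x)"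
    using AE_atom_prob_pos[OF UW] AE_atom_prob_pos[OF W] AE_space
  proof eventually_elim
    case (elim x)
    have "ln (atom_prob ?UW x / atom_prob W x) \<le> atom_prob ?UW x / atom_prob W x - 1"
      using elim by (intro ln_le_minus_one) simp
    moreover have "atom_prob ?UW x / atom_prob W x \<le> ?q (W x)"
      using g[of "U x" "W x"] elim(3) by (simp add: atom_prob_def divide_right_mono)
    ultimately show ?case
      using elim by (simp add: ln_div)
  qed
  moreover have "integrable M (\<lambda>x. 1 - ?q (W x))"
    using integrable_comp_simple[OF W, of "\<lambda>w. 1 - ?q w"] .
  moreover have "integrable M (\<lambda>x. ln (atom_prob W x) - ln (atom_prob ?UW x))"
    by (intro Bochner_Integration.integrable_diff integrable_ln_atom_prob UW W)
  ultimately have "(\<integral>x. 1 - ?q (W x) \<partial>M) \<le> cond_ent U W"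
    unfolding cond_ent_integral[OF U W] by (intro integral_mono_AE)
  moreover have "(\<integral>x. 1 - ?q (W x) \<partial>M) = 1 - (\<integral>x. ?q (W x) \<partial>M)"
    using integrable_comp_simple[OF W, of ?q]
    by (subst Bochner_Integration.integral_diff) (simp_all add: prob_space)
  moreover have "prob {x \<in> space M. U x \<noteq> g (W x)} = 1 - prob {x \<in> space M. U x = g (W x)}"
    by (subst prob_compl[symmetric, OF meas]) (auto intro: arg_cong[where f=prob])
  ultimately show ?thesis
    using q by (intro exI[of _ g]) linarith
qed

text \<open>An estimate of \<open>U\<close> from \<open>W n\<close> almost surely gives the same
  answer at \<open>x\<close> and at \<open>T x\<close>. So a change of \<open>U\<close> forces an
  error at one of the two points, and both errors have the same probability by invariance of the
  measure.\<close>

lemma AE_comp_eq_if_cond_ent_small: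
  assumes T: "T \<in> measurable M M" "distr M M T = M" and U: "simple_function M U"
    and W: "\<And>n::nat. simple_function M (W n)" and WT: "\<And>n. AE x in M. W n (T x) = W n x"
    and lim: "(\<lambda>n. cond_ent U (W n)) \<longlonglongrightarrow> 0"
  shows "AE x in M. U (T x) = U x"
proof -
  have UT: "simple_function M (\<lambda>x. U (T x))"
    using simple_function_comp[OF T(1) U] .
  have meas: "{x \<in> space M. U (T x) \<noteq> U x} \<in> sets M"
    using sets_simple_pred[OF simple_function_Pair[OF UT U], of "\<lambda>(u, v). u \<noteq> v"] by simp
  have "prob {x \<in> space M. U (T x) \<noteq> U x} \<le> 2 * cond_ent U (W n)" for n
  proof -
    obtain g where g: "prob {x \<in> space M. U x \<noteq> g (W n x)} \<le> cond_ent U (W n)"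
      using exists_estimator[OF U W] by blast
    let ?A = "{x \<in> space M. U x \<noteq> g (W n x)}"
    have A: "?A \<in> sets M"
      using sets_simple_pred[OF simple_function_Pair[OF U W], of "\<lambda>(u, w). u \<noteq> g w"] by simp
    have "prob {x \<in> space M. U (T x) \<noteq> U x} \<le> prob (?A \<union> (T -` ?A \<inter> space M))"
    proof (rule finite_measure_mono_AE)
      show "AE x in M. x \<in> {x \<in> space M. U (T x) \<noteq> U x} \<longrightarrow> x \<in> ?A \<union> (T -` ?A \<inter> space M)"
        using WT[of n] AE_space
      proof eventually_elim
        case (elim x)
        then show ?case
          using measurable_space[OF T(1), of x] by auto
      qed
    qed (intro sets.Un A measurable_sets[OF T(1)])
    also have "\<dots> \<le> prob ?A + prob (T -` ?A \<inter> space M)"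
      by (intro measure_Un_le A measurable_sets[OF T(1)])
    also have "prob (T -` ?A \<inter> space M) = prob ?A"
      using measure_distr[OF T(1) , of ?A] A T(2) by simp
    finally show ?thesis
      using g by simp
  qed
  moreover have "(\<lambda>n. 2 * cond_ent U (W n)) \<longlonglongrightarrow> 2 * 0"
    by (intro tendsto_intros lim)
  ultimately have "prob {x \<in> space M. U (T x) \<noteq> U x} \<le> 0"
    by (intro LIMSEQ_le_const[where X="\<lambda>n. 2 * cond_ent U (W n)"]) auto
  then have "prob {x \<in> space M. U (T x) \<noteq> U x} = 0"
    by (simp add: measure_le_0_iff)
  then have "AE x in M. x \<notin> {x \<in> space M. U (T x) \<noteq> U x}"
    using prob_eq_0[OF meas] by simp
  then show ?thesis
    using AE_space by eventually_elim auto
qed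

section \<open>Refining partitions that generate the sigma-algebra\<close>

lemma simple_function_mem: "A \<in> sets M \<Longrightarrow> simple_function M (\<lambda>x. x \<in> A)"
  unfolding simple_function_def
proof safe
  fix x assume "A \<in> sets M"
  then show "(\<lambda>x. x \<in> A) -` {x \<in> A} \<inter> space M \<in> sets M"
    by (cases "x \<in> A") (auto simp: vimage_def Int_def[symmetric] intro: sets.Int sets.Diff
        intro!: back_subst[of "\<lambda>B. B \<in> sets M"])
qed (simp add: finite_subset[of _ UNIV])

text \<open>Any bound tending to 0 with \<open>p = prob A\<close> serves the approximation argument
  below. This one follows from \<open>ln t \<le> t - 1\<close> at \<open>t = 1 / sqrt p\<close> and
  at \<open>t = 1 / (1 - p)\<close>.\<close>

lemma partition_entropy_mem_le:
  assumes A: "A \<in> sets M"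
  shows "partition_entropy M (\<lambda>x. x \<in> A) \<le> 2 * sqrt (prob A) + prob A"
proof -
  let ?U = "\<lambda>x. x \<in> A"
  let ?p = "\<lambda>u. prob {y \<in> space M. (y \<in> A) = u}"
  have A': "{y \<in> space M. (y \<in> A) = True} = A" "{y \<in> space M. (y \<in> A) = False} = space M - A"
    using sets.sets_into_space[OF A] by auto
  have "partition_entropy M ?U = - (\<Sum>u\<in>?U ` space M. ?p u * ln (?p u))"
    by (rule partition_entropy_sum[OF simple_function_mem[OF A]])
  also have "(\<Sum>u\<in>?U ` space M. ?p u * ln (?p u)) = (\<Sum>u\<in>UNIV. ?p u * ln (?p u))"
  proof (rule sum.mono_neutral_left)
    show "\<forall>u\<in>UNIV - ?U ` space M. ?p u * ln (?p u) = 0"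
    proof
      fix u assume "u \<in> UNIV - ?U ` space M"
      then have empty: "{y \<in> space M. (y \<in> A) = u} = {}" by auto
      show "?p u * ln (?p u) = 0"
        unfolding empty by simp
    qed
  qed auto
  also have "\<dots> = prob A * ln (prob A) + (1 - prob A) * ln (1 - prob A)"
    using A' prob_compl[OF A] by (simp add: UNIV_bool)
  finally have eq: "partition_entropy M ?U
    = - (prob A * ln (prob A)) - (1 - prob A) * ln (1 - prob A)" by simp
  have a: "- (prob A * ln (prob A)) \<le> 2 * sqrt (prob A)"
  proof (cases "prob A = 0")
    case False
    then have p: "0 < prob A"
      by (simp add: zero_less_measure_iff)
    have "- ln (prob A) = 2 * ln (1 / sqrt (prob A))"
      using p by (simp add: ln_div ln_sqrt)
    also have "\<dots> \<le> 2 * (1 / sqrt (prob A))"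
      using ln_le_minus_one[of "1 / sqrt (prob A)"] p by simp
    finally have "prob A * (- ln (prob A)) \<le> prob A * (2 * (1 / sqrt (prob A)))"
      using p by (intro mult_left_mono) auto
    also have "\<dots> = 2 * sqrt (prob A)"
      using p by (simp add: field_simps)
    finally show ?thesis by simp
  qed simp
  have b: "- ((1 - prob A) * ln (1 - prob A)) \<le> prob A"
  proof (cases "prob A = 1")
    case False
    then have p: "0 < 1 - prob A"
      using prob_le_1[of A] by linarith
    have "- ln (1 - prob A) = ln (1 / (1 - prob A))"
      using p by (simp add: ln_div)
    also have "\<dots> \<le> 1 / (1 - prob A) - 1"
      using p by (intro ln_le_minus_one) simp
    finally have "(1 - prob A) * (- ln (1 - prob A)) \<le> (1 - prob A) * (1 / (1 - prob A) - 1)"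
      using p by (intro mult_left_mono) auto
    also have "\<dots> = prob A"
      using p by (simp add: field_simps)
    finally show ?thesis by simp
  qed simp
  show ?thesis
    using eq a b by simp
qed

text \<open>A substitute for martingale convergence, by induction over the generated sigma-algebra.
  Sets of \<open>E\<close> are decided by some \<open>W n\<close>, a complement has the same
  partition, and a countable union differs from a finite one by a set of small measure, hence of
  small entropy.\<close>

lemma cond_ent_mem_tendsto_0:
  fixes W :: "nat \<Rightarrow> 'a \<Rightarrow> 'c"
  assumes W: "\<And>n. simple_function M (W n)"
    and refine: "\<And>m n x y. m \<le> n \<Longrightarrow> x \<in> space M \<Longrightarrow> y \<in> space M \<Longrightarrow> W n x = W n y \<Longrightarrow> W m x = W m y"
    and sets: "sets M = sigma_sets (space M) E"
    and E: "\<And>A. A \<in> E \<Longrightarrow> \<exists>n. \<forall>x\<in>space M. \<forall>y\<in>space M. W n x = W n y \<longrightarrow> (x \<in> A \<longleftrightarrow> y \<in> A)"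
    and A: "A \<in> sets M"
  shows "(\<lambda>n. cond_ent (\<lambda>x. x \<in> A) (W n)) \<longlonglongrightarrow> 0"
  using A[unfolded sets]
proof induction
  case (Basic A)
  then have A: "A \<in> sets M"
    using sets by auto
  obtain m where m: "\<And>x y. x \<in> space M \<Longrightarrow> y \<in> space M \<Longrightarrow> W m x = W m y \<Longrightarrow> x \<in> A \<longleftrightarrow> y \<in> A"
    using E[OF Basic] by blast
  have "cond_ent (\<lambda>x. x \<in> A) (W n) = 0" if "m \<le> n" for n
    by (rule cond_ent_eq_0[OF simple_function_mem[OF A] W]) (metis m refine[OF that])
  then show ?case
    by (intro tendsto_eventually) (auto simp: eventually_sequentially)
next
  case Empty
  show ?case
    using cond_ent_eq_0[OF simple_function_mem[OF sets.empty_sets] W] by simp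
next
  case (Compl A)
  then have A: "A \<in> sets M" "space M - A \<in> sets M"
    using sets by auto
  have "cond_ent (\<lambda>x. x \<in> space M - A) (W n) = cond_ent (\<lambda>x. x \<in> A) (W n)" for n
    by (rule cond_ent_eq_pointwise[OF simple_function_mem[OF A(2)] simple_function_mem[OF A(1)] W]) auto
  then show ?case
    using Compl by simp
next
  case (Union a)
  have a[measurable]: "a i \<in> sets M" for i
    using Union(1) sets by auto
  define B where "B k = (\<Union>i<k. a i)" for k
  have B[measurable]: "B k \<in> sets M" for k
    unfolding B_def by measurable
  have UN[measurable]: "(\<Union>i. a i) \<in> sets M"
    by measurable
  note mem = simple_function_mem[OF B] simple_function_mem[OF UN] simple_function_mem[OF a]
  have limB: "(\<lambda>n. cond_ent (\<lambda>x. x \<in> B k) (W n)) \<longlonglongrightarrow> 0" for k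
  proof (induction k)
    case 0
    show ?case
      using cond_ent_eq_0[OF simple_function_mem[OF sets.empty_sets] W] by (simp add: B_def)
  next
    case (Suc k)
    show ?case
    proof (rule tendsto_sandwich[where f="\<lambda>_. 0"])
      show "(\<lambda>n. cond_ent (\<lambda>x. x \<in> B k) (W n) + cond_ent (\<lambda>x. x \<in> a k) (W n)) \<longlonglongrightarrow> 0"
        using tendsto_add[OF Suc Union(2)[of k]] by simp
      show "\<forall>\<^sub>F n in sequentially. cond_ent (\<lambda>x. x \<in> B (Suc k)) (W n)
          \<le> cond_ent (\<lambda>x. x \<in> B k) (W n) + cond_ent (\<lambda>x. x \<in> a k) (W n)"
        by (intro always_eventually allI cond_ent_subadd mem W) (auto simp: B_def less_Suc_eq)
    qed (auto intro!: always_eventually cond_ent_nonneg mem W)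
  qed
  define D where "D k = (\<Union>i. a i) - B k" for k
  have D[measurable]: "D k \<in> sets M" for k
    unfolding D_def by measurable
  have "(\<lambda>k. prob (B k)) \<longlonglongrightarrow> prob (\<Union>k. B k)"
  proof (rule finite_Lim_measure_incseq)
    show "incseq B"
      unfolding incseq_def B_def by (intro allI impI UN_mono) auto
  qed auto
  moreover have "(\<Union>k. B k) = (\<Union>i. a i)"
    by (auto simp: B_def)
  ultimately have "(\<lambda>k. prob (\<Union>i. a i) - prob (B k)) \<longlonglongrightarrow> prob (\<Union>i. a i) - prob (\<Union>i. a i)"
    by (intro tendsto_diff tendsto_const) simp
  moreover have "prob (D k) = prob (\<Union>i. a i) - prob (B k)" for k
    unfolding D_def by (rule finite_measure_Diff) (auto simp: B_def)
  ultimately have limD: "(\<lambda>k. prob (D k)) \<longlonglongrightarrow> 0"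
    by simp
  have limH: "(\<lambda>k. 2 * sqrt (prob (D k)) + prob (D k)) \<longlonglongrightarrow> 0"
    by (rule tendsto_eq_intros limD refl | simp)+
  show ?case
  proof (rule LIMSEQ_I)
    fix r :: real assume r: "0 < r"
    \<comment> \<open>\<open>k\<close> is fixed first, which makes the entropy of the remainder
      \<open>D k\<close> small for all \<open>n\<close> at once; only then is \<open>N\<close>
      chosen for the finite union \<open>B k\<close>.\<close>
    obtain k where k: "2 * sqrt (prob (D k)) + prob (D k) < r / 2"
      using order_tendstoD(2)[OF limH, of "r / 2"] r by (auto simp: eventually_sequentially)
    obtain N where N: "\<And>n. N \<le> n \<Longrightarrow> cond_ent (\<lambda>x. x \<in> B k) (W n) < r / 2"
      using order_tendstoD(2)[OF limB, of "r / 2"] r by (auto simp: eventually_sequentially)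
    have "norm (cond_ent (\<lambda>x. x \<in> (\<Union>i. a i)) (W n) - 0) < r" if n: "N \<le> n" for n
    proof -
      have "cond_ent (\<lambda>x. x \<in> (\<Union>i. a i)) (W n)
          \<le> cond_ent (\<lambda>x. x \<in> D k) (W n) + cond_ent (\<lambda>x. x \<in> B k) (W n)"
        by (intro cond_ent_subadd mem W simple_function_mem[OF D]) (auto simp: D_def B_def)
      also have "cond_ent (\<lambda>x. x \<in> D k) (W n) \<le> partition_entropy M (\<lambda>x. x \<in> D k)"
        by (intro cond_ent_le_entropy simple_function_mem D W)
      also have "\<dots> \<le> 2 * sqrt (prob (D k)) + prob (D k)"
        by (rule partition_entropy_mem_le[OF D])
      finally show ?thesis
        using k N[OF n] cond_ent_nonneg[OF mem(2) W, of n] by simp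
    qed
    then show "\<exists>N. \<forall>n\<ge>N. norm (cond_ent (\<lambda>x. x \<in> (\<Union>i. a i)) (W n) - 0) < r"
      by blast
  qed
qed

text \<open>Subadditivity assembles \<open>U\<close> from the indicators of its finitely many values
  and so reduces the claim to sets.\<close>

lemma cond_ent_tendsto_0:
  fixes W :: "nat \<Rightarrow> 'a \<Rightarrow> 'c"
  assumes W: "\<And>n. simple_function M (W n)"
    and refine: "\<And>m n x y. m \<le> n \<Longrightarrow> x \<in> space M \<Longrightarrow> y \<in> space M \<Longrightarrow> W n x = W n y \<Longrightarrow> W m x = W m y"
    and sets: "sets M = sigma_sets (space M) E"
    and E: "\<And>A. A \<in> E \<Longrightarrow> \<exists>n. \<forall>x\<in>space M. \<forall>y\<in>space M. W n x = W n y \<longrightarrow> (x \<in> A \<longleftrightarrow> y \<in> A)"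
    and U: "simple_function M U"
  shows "(\<lambda>n. cond_ent U (W n)) \<longlonglongrightarrow> 0"
proof -
  let ?U = "\<lambda>S x. U x \<in> S"
  have US: "simple_function M (?U S)" for S
    by (rule simple_function_compose1[OF U])
  have lim1: "(\<lambda>n. cond_ent (\<lambda>x. U x = u) (W n)) \<longlonglongrightarrow> 0" for u
  proof -
    have "cond_ent (\<lambda>x. x \<in> {y \<in> space M. U y = u}) (W n) = cond_ent (\<lambda>x. U x = u) (W n)" for n
      by (rule cond_ent_eq_pointwise[OF simple_function_mem[OF sets_simple_eq[OF U]] simple_function_compose1[OF U] W]) auto
    moreover have "(\<lambda>n. cond_ent (\<lambda>x. x \<in> {y \<in> space M. U y = u}) (W n)) \<longlonglongrightarrow> 0"
      by (rule cond_ent_mem_tendsto_0[OF W _ sets _ sets_simple_eq[OF U]])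
         (rule refine, assumption+, erule E)
    ultimately show ?thesis
      by simp
  qed
  \<comment> \<open>The label \<open>None\<close> lumps together the values outside
    \<open>S\<close>; each induction step separates one more value.\<close>
  have "(\<lambda>n. cond_ent (\<lambda>x. if U x \<in> S then Some (U x) else None) (W n)) \<longlonglongrightarrow> 0" if "finite S" for S
    using that
  proof induction
    case empty
    have "cond_ent (\<lambda>x. None :: 'b option) (W n) = 0" for n
      by (rule cond_ent_eq_0[OF simple_function_const W]) simp
    then show ?case
      by simp
  next
    case (insert u S)
    let ?V = "\<lambda>S x. if U x \<in> S then Some (U x) else None"
    have V: "simple_function M (?V S)" for S
      by (rule simple_function_compose1[OF U])
    show ?case
    proof (rule tendsto_sandwich[where f="\<lambda>_. 0"])
      show "(\<lambda>n. cond_ent (?V S) (W n) + cond_ent (\<lambda>x. U x = u) (W n)) \<longlonglongrightarrow> 0"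
        using tendsto_add[OF insert(3) lim1[of u]] by simp
      show "\<forall>\<^sub>F n in sequentially. cond_ent (?V (insert u S)) (W n)
          \<le> cond_ent (?V S) (W n) + cond_ent (\<lambda>x. U x = u) (W n)"
        by (intro always_eventually allI cond_ent_subadd V W simple_function_compose1[OF U])
           (auto split: if_splits)
      show "\<forall>\<^sub>F n in sequentially. 0 \<le> cond_ent (?V (insert u S)) (W n)"
        by (intro always_eventually allI cond_ent_nonneg V W)
    qed simp
  qed
  from this[OF simple_functionD(1)[OF U]]
  have "(\<lambda>n. cond_ent (\<lambda>x. if U x \<in> U ` space M then Some (U x) else None) (W n)) \<longlonglongrightarrow> 0" .
  moreover have "cond_ent (\<lambda>x. if U x \<in> U ` space M then Some (U x) else None) (W n) = cond_ent U (W n)" for n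
    by (rule cond_ent_eq_pointwise[OF simple_function_compose1[OF U] U W]) auto
  ultimately show ?thesis by simp
qed

end

section \<open>Orbit words\<close>

text \<open>The same list as \<open>itinerary\<close>, but with labels of any type: group elements
  serve as letters below, and invariant functions of unspecified type as labels.\<close>

definition orbit_word :: "('x \<Rightarrow> 'x) \<Rightarrow> ('x \<Rightarrow> 'c) \<Rightarrow> nat \<Rightarrow> 'x \<Rightarrow> 'c list" where
  "orbit_word T U n x = map (\<lambda>i. U ((T ^^ i) x)) [0..<n]"

lemma itinerary_eq_orbit_word: "itinerary T U n = orbit_word T U n"
  by (simp add: itinerary_def orbit_word_def fun_eq_iff)

lemma orbit_word_0 [simp]: "orbit_word T U 0 x = []"
  by (simp add: orbit_word_def)

lemma orbit_word_Suc: "orbit_word T U (Suc n) x = U x # orbit_word T U n (T x)"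
  by (simp add: orbit_word_def upt_conv_Cons map_Suc_upt[symmetric] funpow_swap1 del: upt_Suc)

lemma orbit_word_eq_iff:
  "orbit_word T U n x = orbit_word T U n y \<longleftrightarrow> (\<forall>i<n. U ((T ^^ i) x) = U ((T ^^ i) y))"
  by (auto simp: orbit_word_def map_eq_conv)

section \<open>Invariant measures\<close>

lemma invariant_underD:
  assumes "invariant_under M T"
  shows "T \<in> measurable M M" "distr M M T = M"
  using assms by (auto simp: invariant_under_def)

lemma AE_invariant_under:
  assumes T: "invariant_under M T" and P: "AE x in M. P x"
  shows "AE x in M. P (T x)"
proof (rule AE_distrD[OF invariant_underD(1)[OF T]])
  show "AE x in distr M M T. P x"
    unfolding invariant_underD(2)[OF T] by (rule P)
qed

lemma invariant_under_funpow:
  assumes T: "invariant_under M T"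
  shows "invariant_under M (T ^^ n)"
proof (induction n)
  case 0
  show ?case
    by (simp add: invariant_under_def distr_id[unfolded id_def] id_def)
next
  case (Suc n)
  note m = invariant_underD[OF T] invariant_underD[OF Suc]
  have "distr M M (T \<circ> (T ^^ n)) = M"
    using distr_distr[OF m(1,3)] m(2,4) by simp
  then show ?case
    using measurable_comp[OF m(3,1)] unfolding invariant_under_def funpow.simps by blast
qed

lemma measurable_invariant_space:
  "invariant_under M T \<Longrightarrow> x \<in> space M \<Longrightarrow> T x \<in> space M"
  by (meson invariant_underD(1) measurable_space)

lemma simple_function_invariant:
  "invariant_under M T \<Longrightarrow> simple_function M U \<Longrightarrow> simple_function M (\<lambda>x. U (T x))"
  using simple_function_comp[OF invariant_underD(1)] .

lemma simple_function_orbit_word: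
  assumes "T \<in> measurable M M" "simple_function M U"
  shows "simple_function M (orbit_word T U n)"
proof (induction n)
  case 0
  show ?case
    using simple_function_const[of M "[]"] by (simp cong: simple_function_cong)
next
  case (Suc n)
  show ?case
    using simple_function_compose2[OF assms(2) simple_function_comp[OF assms(1) Suc], of Cons]
    by (simp add: orbit_word_Suc cong: simple_function_cong)
qed

text \<open>If \<open>c m < h\<close>, all later terms are at most \<open>c m\<close> as well, and
  the partial sums grow too slowly to stay above the line of slope \<open>h\<close>.\<close>

lemma le_if_le_sum_antimono:
  fixes c :: "nat \<Rightarrow> real"
  assumes mono: "\<And>m n. m \<le> n \<Longrightarrow> c n \<le> c m" and ge: "\<And>n. real n * h \<le> (\<Sum>j<n. c j)"
  shows "h \<le> c m"
proof (rule ccontr)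
  assume "\<not> h \<le> c m"
  then have pos: "0 < h - c m" by simp
  obtain k :: nat where k: "(\<Sum>j<m. c j) - real m * h < real k * (h - c m)"
    using reals_Archimedean3[OF pos] by blast
  have "(\<Sum>j<m + k. c j) = (\<Sum>j<m. c j) + (\<Sum>j=m..<m + k. c j)"
    by (metis atLeast0LessThan le_add1 sum.atLeastLessThan_concat zero_le)
  also have "(\<Sum>j=m..<m + k. c j) \<le> real k * c m"
    using sum_bounded_above[of "{m..<m + k}" c "c m"] mono by simp
  finally have "real (m + k) * h \<le> (\<Sum>j<m. c j) + real k * c m"
    using ge[of "m + k"] by linarith
  with k show False
    by (simp add: algebra_simps)
qed

lemma Cesaro_null:
  fixes e :: "nat \<Rightarrow> real"
  assumes lim: "e \<longlonglongrightarrow> 0"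
  shows "(\<lambda>n. (\<Sum>j<n. e j) / real n) \<longlonglongrightarrow> 0"
proof (rule LIMSEQ_I)
  fix r :: real assume r: "0 < r"
  obtain N where N: "\<And>n. N \<le> n \<Longrightarrow> \<bar>e n\<bar> < r / 2"
    using LIMSEQ_D[OF lim, of "r / 2"] r by auto
  \<comment> \<open>From \<open>K\<close> on, the first \<open>N\<close> terms contribute less than
    \<open>r / 2\<close> to the average.\<close>
  obtain K :: nat where K: "2 * (\<Sum>j<N. \<bar>e j\<bar>) < real K * r"
    using reals_Archimedean3[OF r] by blast
  have "norm ((\<Sum>j<n. e j) / real n - 0) < r" if n: "max (Suc N) K \<le> n" for n
  proof -
    have "\<bar>\<Sum>j<n. e j\<bar> \<le> (\<Sum>j<n. \<bar>e j\<bar>)"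
      by (rule sum_abs)
    also have "\<dots> = (\<Sum>j<N. \<bar>e j\<bar>) + (\<Sum>j=N..<n. \<bar>e j\<bar>)"
      using n by (metis atLeast0LessThan max.bounded_iff Suc_leD sum.atLeastLessThan_concat zero_le)
    also have "(\<Sum>j=N..<n. \<bar>e j\<bar>) \<le> real (n - N) * (r / 2)"
      using sum_bounded_above[of "{N..<n}" "\<lambda>j. \<bar>e j\<bar>" "r / 2"] N by (simp add: less_imp_le)
    also have "\<dots> \<le> real n * (r / 2)"
      using r by (intro mult_right_mono) auto
    also have "(\<Sum>j<N. \<bar>e j\<bar>) < real n * (r / 2)"
    proof -
      have "real K * r \<le> real n * r"
        using n r by (intro mult_right_mono) auto
      then show ?thesis using K by linarith
    qed
    finally show ?thesis
      using n by (simp add: field_simps)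
  qed
  then show "\<exists>N. \<forall>n\<ge>N. norm ((\<Sum>j<n. e j) / real n - 0) < r"
    by blast
qed

section \<open>Conditional entropy of orbit words\<close>

context prob_space
begin

text \<open>The word of length \<open>k * n\<close> consists of \<open>k\<close> blocks of length
  \<open>n\<close>. All blocks have the same conditional entropy given \<open>Q\<close>, since
  \<open>Q\<close> is almost surely constant along orbits.\<close>

lemma cond_ent_orbit_word_mult_le:
  assumes T: "invariant_under M T" and U: "simple_function M U" and Q: "simple_function M Q"
    and QT: "AE x in M. Q (T x) = Q x"
  shows "cond_ent (orbit_word T U (k * n)) Q \<le> real k * cond_ent (orbit_word T U n) Q"
proof (induction k)
  case 0
  have "cond_ent (orbit_word T U 0) Q = 0"
    by (rule cond_ent_eq_0) (simp_all add: simple_function_orbit_word invariant_underD(1)[OF T] U Q)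
  then show ?case by (simp del: orbit_word_0)
next
  case (Suc k)
  note Tn = invariant_under_funpow[OF T, of n]
  note w = simple_function_orbit_word[OF invariant_underD(1)[OF T] U]
  have QTm: "AE x in M. Q ((T ^^ m) x) = Q x" for m
  proof (induction m)
    case (Suc m)
    show ?case
      using AE_invariant_under[OF invariant_under_funpow[OF T, of m] QT] Suc by eventually_elim simp
  qed simp
  have "cond_ent (orbit_word T U (Suc k * n)) Q
      \<le> cond_ent (orbit_word T U n) Q + cond_ent (\<lambda>x. orbit_word T U (k * n) ((T ^^ n) x)) Q"
  proof (rule cond_ent_subadd[OF w simple_function_invariant[OF Tn w] Q w])
    fix x y
    assume *: "orbit_word T U n x = orbit_word T U n y"
      "orbit_word T U (k * n) ((T ^^ n) x) = orbit_word T U (k * n) ((T ^^ n) y)"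
    show "orbit_word T U (Suc k * n) x = orbit_word T U (Suc k * n) y"
      unfolding orbit_word_eq_iff
    proof (intro allI impI)
      fix i assume i: "i < Suc k * n"
      show "U ((T ^^ i) x) = U ((T ^^ i) y)"
      proof (cases "i < n")
        case True
        then show ?thesis
          using *(1) by (simp add: orbit_word_eq_iff)
      next
        case False
        then have "i - n < k * n" "i = (i - n) + n"
          using i by auto
        then show ?thesis
          using *(2) unfolding orbit_word_eq_iff by (metis comp_apply funpow_add)
      qed
    qed
  qed
  also have "cond_ent (\<lambda>x. orbit_word T U (k * n) ((T ^^ n) x)) Q
      = cond_ent (\<lambda>x. orbit_word T U (k * n) ((T ^^ n) x)) (\<lambda>x. Q ((T ^^ n) x))"
    using QTm[of n]
    by (intro cond_ent_cong_AE simple_function_invariant[OF Tn] w Q) (auto simp: eq_commute)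
  also have "\<dots> = cond_ent (orbit_word T U (k * n)) Q"
    by (intro cond_ent_comp invariant_underD[OF Tn] w Q)
  finally show ?case
    using Suc by (simp add: algebra_simps)
qed

text \<open>
  A \<open>T\<close>-invariant finite-valued \<open>Q\<close> carries only finitely much information, which is negligible
  against that of long orbit words.
\<close>

lemma cond_ent_orbit_word_invariant_ge:
  assumes T: "invariant_under M T" and U: "simple_function M U" and Q: "simple_function M Q"
    and QT: "AE x in M. Q (T x) = Q x"
    and h: "\<And>n. real n * h \<le> partition_entropy M (orbit_word T U n)"
  shows "real n * h \<le> cond_ent (orbit_word T U n) Q"
proof (rule ccontr)
  note w = simple_function_orbit_word[OF invariant_underD(1)[OF T] U]
  assume "\<not> real n * h \<le> cond_ent (orbit_word T U n) Q"
  then have pos: "0 < real n * h - cond_ent (orbit_word T U n) Q" by simp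
  \<comment> \<open>Over \<open>k\<close> blocks the accumulated deficit exceeds the fixed entropy
    of \<open>Q\<close>.\<close>
  obtain k :: nat where k: "partition_entropy M Q < real k * (real n * h - cond_ent (orbit_word T U n) Q)"
    using reals_Archimedean3[OF pos] by blast
  have "real (k * n) * h \<le> partition_entropy M (orbit_word T U (k * n))"
    by (rule h)
  also have "\<dots> \<le> partition_entropy M (\<lambda>x. (orbit_word T U (k * n) x, Q x))"
    by (intro partition_entropy_mono_pointwise simple_function_Pair w Q) simp
  also have "\<dots> = cond_ent (orbit_word T U (k * n)) Q + partition_entropy M Q"
    by (simp add: cond_ent_def)
  also have "\<dots> \<le> real k * cond_ent (orbit_word T U n) Q + partition_entropy M Q"
    using cond_ent_orbit_word_mult_le[OF T U Q QT] by simp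
  finally show False
    using k by (simp add: algebra_simps)
qed

text \<open>By the chain rule, each letter is conditioned on the letters after it and on labels.
  Discarding all labels but the one at its own position only increases the terms.\<close>

lemma cond_ent_orbit_words_le_sum:
  assumes T: "invariant_under M T" and U: "simple_function M U" and P: "simple_function M P"
  shows "cond_ent (orbit_word T U n) (orbit_word T P n)
    \<le> (\<Sum>j<n. cond_ent U (\<lambda>x. (orbit_word T U j (T x), P x)))"
proof (induction n)
  case 0
  have "cond_ent (orbit_word T U 0) (orbit_word T P 0) = 0"
    by (rule cond_ent_eq_0) (simp_all add: simple_function_orbit_word invariant_underD(1)[OF T] U P)
  then show ?case by (simp del: orbit_word_0)
next
  case (Suc n)
  note w = simple_function_orbit_word[OF invariant_underD(1)[OF T]]
  note wT = simple_function_invariant[OF T w]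
  have "cond_ent (orbit_word T U (Suc n)) (orbit_word T P (Suc n))
      = cond_ent (\<lambda>x. orbit_word T U n (T x)) (orbit_word T P (Suc n))
        + cond_ent U (\<lambda>x. (orbit_word T U n (T x), orbit_word T P (Suc n) x))"
    by (rule cond_ent_chain[OF U wT[OF U] w[OF P] w[OF U]]) (simp add: orbit_word_Suc)
  also have "cond_ent (\<lambda>x. orbit_word T U n (T x)) (orbit_word T P (Suc n))
      \<le> cond_ent (\<lambda>x. orbit_word T U n (T x)) (\<lambda>x. orbit_word T P n (T x))"
    by (rule cond_ent_antimono[OF wT[OF U] wT[OF P] w[OF P]]) (simp add: orbit_word_Suc)
  also have "\<dots> = cond_ent (orbit_word T U n) (orbit_word T P n)"
    by (intro cond_ent_comp invariant_underD[OF T] w U P)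
  also have "cond_ent U (\<lambda>x. (orbit_word T U n (T x), orbit_word T P (Suc n) x))
      \<le> cond_ent U (\<lambda>x. (orbit_word T U n (T x), P x))"
    by (intro cond_ent_antimono simple_function_Pair wT w U P) (simp add: orbit_word_Suc)
  finally show ?case
    using Suc by simp
qed

text \<open>Each label is conditioned only on the letters from its position on. Invariance moves
  that position to 0, leaving words of lengths 1 to \<open>n\<close>, whence
  \<open>Suc j\<close>.\<close>

lemma cond_ent_orbit_word_le_sum:
  assumes T: "invariant_under M T" and U: "simple_function M U" and P: "simple_function M P"
  shows "cond_ent (orbit_word T P n) (orbit_word T U n)
    \<le> (\<Sum>j<n. cond_ent P (orbit_word T U (Suc j)))"
proof (induction n)
  case 0
  have "cond_ent (orbit_word T P 0) (orbit_word T U 0) = 0"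
    by (rule cond_ent_eq_0) (simp_all add: simple_function_orbit_word invariant_underD(1)[OF T] U P)
  then show ?case by (simp del: orbit_word_0)
next
  case (Suc n)
  note w = simple_function_orbit_word[OF invariant_underD(1)[OF T]]
  note wT = simple_function_invariant[OF T w]
  have "cond_ent (orbit_word T P (Suc n)) (orbit_word T U (Suc n))
      \<le> cond_ent P (orbit_word T U (Suc n))
        + cond_ent (\<lambda>x. orbit_word T P n (T x)) (orbit_word T U (Suc n))"
    by (rule cond_ent_subadd[OF P wT[OF P] w[OF U] w[OF P]]) (simp add: orbit_word_Suc)
  also have "cond_ent (\<lambda>x. orbit_word T P n (T x)) (orbit_word T U (Suc n))
      \<le> cond_ent (\<lambda>x. orbit_word T P n (T x)) (\<lambda>x. orbit_word T U n (T x))"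
    by (rule cond_ent_antimono[OF wT[OF P] wT[OF U] w[OF U]]) (simp add: orbit_word_Suc)
  also have "\<dots> = cond_ent (orbit_word T P n) (orbit_word T U n)"
    by (intro cond_ent_comp invariant_underD[OF T] w U P)
  finally show ?case
    using Suc by simp
qed

lemma partition_entropy_orbit_word_Suc:
  assumes T: "invariant_under M T" and U: "simple_function M U"
  shows "partition_entropy M (orbit_word T U (Suc n))
    = cond_ent U (\<lambda>x. orbit_word T U n (T x)) + partition_entropy M (orbit_word T U n)"
proof -
  note w = simple_function_orbit_word[OF invariant_underD(1)[OF T] U]
  note wT = simple_function_invariant[OF T w]
  have "partition_entropy M (orbit_word T U (Suc n)) = partition_entropy M (\<lambda>x. (U x, orbit_word T U n (T x)))"
    by (intro partition_entropy_eq_pointwise simple_function_Pair w wT U) (simp add: orbit_word_Suc)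
  then show ?thesis
    using partition_entropy_comp[OF invariant_underD[OF T] w] by (simp add: cond_ent_def)
qed

text \<open>\<open>AE_invariant_under\<close> passes from \<open>x\<close> to \<open>T x\<close>;
  the way back is open because \<open>U\<close> makes the event measurable.\<close>

lemma AE_comp_iff_simple:
  assumes T: "invariant_under M T" and U: "simple_function M U"
  shows "(AE x in M. P (U (T x))) \<longleftrightarrow> (AE x in M. P (U x))"
  using AE_distr_iff[OF invariant_underD(1)[OF T] sets_simple_pred[OF U, of P]]
  unfolding invariant_underD(2)[OF T] by (rule sym)

end

section \<open>Functions invariant under the cellular automaton\<close>

lemma measurable_full_shiftI:
  assumes "\<And>i. (\<lambda>x. f x i) \<in> measurable N (count_space A)"
  shows "f \<in> measurable N (full_shift A)"
proof -
  have "(\<lambda>x i. f x i) \<in> measurable N (PiM UNIV (\<lambda>_. count_space A))"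
  proof (rule measurable_PiM_single')
    show "(\<lambda>x i. f x i) \<in> space N \<rightarrow> (\<Pi>\<^sub>E i\<in>UNIV. space (count_space A))"
      using measurable_space[OF assms] by auto
  qed (use assms in auto)
  then show ?thesis
    by (simp add: full_shift_def)
qed

lemma space_full_shift: "space (full_shift A) = {x. \<forall>i. x i \<in> A}"
  by (auto simp: full_shift_def space_PiM)

lemma measurable_full_shift_coordinate: "(\<lambda>x. x i) \<in> measurable (full_shift A) (count_space A)"
  unfolding full_shift_def by measurable

lemma simple_function_count_spaceI:
  assumes U: "U \<in> measurable N (count_space A)" and A: "finite A"
  shows "simple_function N U"
  unfolding simple_function_def
proof safe
  show "finite (U ` space N)"
    using measurable_space[OF U] by (intro finite_subset[OF _ A]) auto
  fix x assume "x \<in> space N"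
  then show "U -` {U x} \<inter> space N \<in> sets N"
    using measurable_space[OF U] by (intro measurable_sets[OF U]) auto
qed

lemma measurable_count_space_simple:
  assumes U: "simple_function N U" and A: "\<And>x. x \<in> space N \<Longrightarrow> U x \<in> A"
  shows "U \<in> measurable N (count_space A)"
proof (rule measurableI)
  fix B
  show "U -` B \<inter> space N \<in> sets N"
    using measurable_sets[OF measurable_simple_function[OF U], of B] by simp
qed (use A in auto)

lemma funpow_shift: "(shift ^^ n) x i = x (i + n)"
  by (induction n arbitrary: i) (auto simp: shift_def)

definition left_mult_0 :: "('a, 'b) monoid_scheme \<Rightarrow> 'a \<Rightarrow> (nat \<Rightarrow> 'a) \<Rightarrow> nat \<Rightarrow> 'a" where
  "left_mult_0 G h x = x(0 := h \<otimes>\<^bsub>G\<^esub> x 0)"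

lemma left_mult_0_simps [simp]:
  "left_mult_0 G h x 0 = h \<otimes>\<^bsub>G\<^esub> x 0" "left_mult_0 G h x (Suc i) = x (Suc i)"
  "shift (left_mult_0 G h x) = shift x"
  by (simp_all add: left_mult_0_def shift_def)

text \<open>The automaton does not enter here. In this setting the conditional measures are
  analysed, which later supplies the facts on cosets and left multiplication that
  \<open>coset_uniform_measure\<close> assumes.\<close>

locale normal_shift_measure =
  prob_space \<mu> + group G for G :: "('a, 'b) monoid_scheme" (structure) and \<mu> :: "(nat \<Rightarrow> 'a) measure" +
  fixes H :: "'a set"
  assumes finite_carrier: "finite (carrier G)"
    and sets_eq: "sets \<mu> = sets (full_shift (carrier G))"
    and shift_invariant: "invariant_under \<mu> shift"
    and normal: "H \<lhd> G"
begin

sublocale H: normal H G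
  by (rule normal)

lemma space_eq: "space \<mu> = {x. \<forall>i. x i \<in> carrier G}"
  using sets_eq_imp_space_eq[OF sets_eq] by (simp add: space_full_shift)

lemma finite_H: "finite H"
  using finite_subset[OF H.subset finite_carrier] .

lemma H_carrier: "h \<in> H \<Longrightarrow> h \<in> carrier G"
  using H.subset by blast

lemma measurable_muI:
  "(\<And>i. (\<lambda>x. f x i) \<in> measurable N (count_space (carrier G))) \<Longrightarrow> f \<in> measurable N \<mu>"
  using measurable_full_shiftI[of f N "carrier G"] measurable_cong_sets[OF refl sets_eq] by blast

lemma measurable_coordinate: "(\<lambda>x. x i) \<in> measurable \<mu> (count_space (carrier G))"
  using measurable_full_shift_coordinate measurable_cong_sets[OF sets_eq refl] by blast

lemma simple_coordinate: "simple_function \<mu> (\<lambda>x. x i)"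
  by (rule simple_function_count_spaceI[OF measurable_coordinate finite_carrier])

lemma coset_left_mult: "h \<in> H \<Longrightarrow> g \<in> carrier G \<Longrightarrow> H #> (h \<otimes> g) = H #> g"
  using coset_mult_assoc[of H h g] coset_join2[of h H] H.subset H.is_subgroup H_carrier by simp

lemma AE_H_all: "(\<And>h. h \<in> H \<Longrightarrow> AE x in \<mu>. P h x) \<Longrightarrow> AE x in \<mu>. \<forall>h\<in>H. P h x"
  by (rule AE_finite_allI[OF finite_H])

end

text \<open>
  The hypotheses on \<open>\<mu>\<close> say that, given \<open>\<sigma>\<^sup>-\<^sup>1\<B>\<close>, the coordinate \<open>x 0\<close> is uniform on a right coset of
  \<open>H\<close>: uniformity is the invariance under \<open>left_mult_0 G h\<close>, and \<open>coset_pred (shift x)\<close> is the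
  coset.
\<close>

locale coset_uniform_measure = normal_shift_measure +
  fixes coset_pred :: "(nat \<Rightarrow> 'a) \<Rightarrow> 'a set"
  assumes ca_invariant: "invariant_under \<mu> (mult_ca G)"
    and left_mult_invariant: "\<And>h. h \<in> H \<Longrightarrow> invariant_under \<mu> (left_mult_0 G h)"
    and simple_coset_pred: "simple_function \<mu> coset_pred"
    and coset_pred: "AE x in \<mu>. coset_pred (shift x) = H #> x 0"
begin

section \<open>Entropy of words and of the letter at index 0\<close>

abbreviation word :: "nat \<Rightarrow> (nat \<Rightarrow> 'a) \<Rightarrow> 'a list" where
  "word \<equiv> orbit_word shift (\<lambda>x. x 0)"

abbreviation entropy_bound :: real where
  "entropy_bound \<equiv> ln (card H)"

lemma simple_word: "simple_function \<mu> (word n)"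
  by (rule simple_function_orbit_word[OF invariant_underD(1)[OF shift_invariant] simple_coordinate])

lemma simple_word_shift: "simple_function \<mu> (\<lambda>x. word n (shift x))"
  by (rule simple_function_invariant[OF shift_invariant simple_word])

lemma word_eq_iff: "word n x = word n y \<longleftrightarrow> (\<forall>i<n. x i = y i)"
  by (simp add: orbit_word_eq_iff funpow_shift)

text \<open>Sets depending on one coordinate generate the sigma-algebra, and a word reaching beyond
  that coordinate decides them.\<close>

lemma cond_ent_word_tendsto_0:
  assumes U: "simple_function \<mu> U"
  shows "(\<lambda>n. cond_ent U (word n)) \<longlonglongrightarrow> 0"
proof (rule cond_ent_tendsto_0[OF simple_word])
  show "sets \<mu> = sigma_sets (space \<mu>) {{x \<in> space \<mu>. x i \<in> A} | i A. A \<subseteq> carrier G}"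
    using sets_PiM_single[of UNIV "\<lambda>_. count_space (carrier G)"] sets_eq_imp_space_eq[OF sets_eq]
    by (simp add: sets_eq full_shift_def space_PiM)
  fix A assume "A \<in> {{x \<in> space \<mu>. x i \<in> A} | i A. A \<subseteq> carrier G}"
  then obtain i B where "A = {x \<in> space \<mu>. x i \<in> B}" by blast
  then show "\<exists>n. \<forall>x\<in>space \<mu>. \<forall>y\<in>space \<mu>. word n x = word n y \<longrightarrow> (x \<in> A \<longleftrightarrow> y \<in> A)"
    by (intro exI[of _ "Suc i"]) (auto simp: word_eq_iff)
qed (auto simp: word_eq_iff U)

text \<open>Left multiplication of \<open>x 0\<close> by \<open>H\<close> preserves the measure, the
  tail and, almost surely, \<open>R\<close>, while it takes \<open>x 0\<close> through
  \<open>card H\<close> distinct values.\<close>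

lemma cond_ent_coordinate_ge:
  assumes R: "simple_function \<mu> R" and inv: "\<And>h. h \<in> H \<Longrightarrow> AE x in \<mu>. R (left_mult_0 G h x) = R x"
  shows "entropy_bound \<le> cond_ent (\<lambda>x. x 0) (\<lambda>x. (word n (shift x), R x))"
proof (rule cond_ent_ge_ln_card[where T="left_mult_0 G" and f="\<lambda>h g. h \<otimes> g"])
  show "AE x in \<mu>. (word n (shift (left_mult_0 G h x)), R (left_mult_0 G h x)) = (word n (shift x), R x)"
    if "h \<in> H" for h
    using inv[OF that] by eventually_elim simp
  show "inj_on (\<lambda>h. h \<otimes> x 0) H" if "x \<in> space \<mu>" for x
    using that by (auto simp: inj_on_def space_eq H_carrier)
  show "H \<noteq> {}"
    using H.one_closed by blast
qed (intro invariant_underD[OF left_mult_invariant] simple_coordinate simple_function_Pair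
    simple_word_shift R finite_H left_mult_0_simps(1) | assumption)+

lemma cond_ent_coordinate_ge_word: "entropy_bound \<le> cond_ent (\<lambda>x. x 0) (\<lambda>x. word n (shift x))"
proof -
  have "entropy_bound \<le> cond_ent (\<lambda>x. x 0) (\<lambda>x. (word n (shift x), ()))"
    by (rule cond_ent_coordinate_ge) auto
  also have "\<dots> \<le> cond_ent (\<lambda>x. x 0) (\<lambda>x. word n (shift x))"
    by (intro cond_ent_antimono simple_function_Pair simple_coordinate simple_word_shift) auto
  finally show ?thesis .
qed

lemma partition_entropy_word_ge: "real n * entropy_bound \<le> partition_entropy \<mu> (word n)"
proof (induction n)
  case 0
  show ?case
    using partition_entropy_nonneg[OF simple_word, of 0] by (simp del: orbit_word_0)
next
  case (Suc n)
  then show ?case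
    using partition_entropy_orbit_word_Suc[OF shift_invariant simple_coordinate] cond_ent_coordinate_ge_word[of n]
    by (simp add: algebra_simps)
qed

text \<open>The value \<one> for sets that are no cosets keeps the representative in the carrier
  even where \<open>coset_pred\<close> takes arbitrary values.\<close>

definition coset_rep :: "'a set \<Rightarrow> 'a" where
  "coset_rep L = (if L \<in> rcosets H then SOME g. g \<in> L else \<one>)"

lemma coset_rep_carrier: "coset_rep L \<in> carrier G"
proof (cases "L \<in> rcosets H")
  case True
  then have "\<exists>g. g \<in> L"
    using H.rcosets_non_empty by blast
  then have "coset_rep L \<in> L"
    using True someI_ex[of "\<lambda>g. g \<in> L"] by (simp add: coset_rep_def)
  then show ?thesis
    using H.rcosets_carrier[OF is_group] True by blast
qed (simp add: coset_rep_def)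

lemma coset_rep_coset:
  assumes g: "g \<in> carrier G"
  shows "\<exists>h\<in>H. coset_rep (H #> g) = h \<otimes> g"
proof -
  have "H #> g \<in> rcosets H"
    using g H.subset by (intro rcosetsI)
  moreover have "g \<in> H #> g"
    using g H.is_subgroup by (rule rcos_self)
  ultimately have "coset_rep (H #> g) \<in> H #> g"
    using someI[of "\<lambda>k. k \<in> H #> g" g] by (simp add: coset_rep_def)
  then show ?thesis
    by (auto simp: r_coset_def)
qed

lemma simple_coset: "simple_function \<mu> (\<lambda>x. H #> x i)"
  by (rule simple_function_compose1[OF simple_coordinate])

text \<open>Write \<open>x 0\<close> as an element of \<open>H\<close> times the representative of
  its coset. The factor takes at most \<open>card H\<close> values, and the coset is almost surely
  \<open>coset_pred\<close> of the tail, which a long word of the tail nearly determines.\<close>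

lemma cond_ent_coordinate_le:
  "cond_ent (\<lambda>x. x 0) (\<lambda>x. word n (shift x)) \<le> entropy_bound + cond_ent coset_pred (word n)"
proof -
  let ?Y = "\<lambda>x. H #> x 0" and ?W = "\<lambda>x. word n (shift x)"
  let ?k = "\<lambda>x. x 0 \<otimes> inv (coset_rep (H #> x 0))"
  have k: "simple_function \<mu> ?k"
    by (rule simple_function_compose1[OF simple_coordinate])
  have "cond_ent (\<lambda>x. x 0) ?W \<le> cond_ent ?Y ?W + cond_ent ?k (\<lambda>x. (?Y x, ?W x))"
  proof (rule cond_ent_le_chain[OF k simple_coset simple_word_shift simple_coordinate])
    fix x y assume "x \<in> space \<mu>" "y \<in> space \<mu>" "?k x = ?k y" "?Y x = ?Y y"
    then show "x 0 = y 0"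
      using coset_rep_carrier by (simp add: space_eq)
  qed
  also have "cond_ent ?k (\<lambda>x. (?Y x, ?W x)) \<le> partition_entropy \<mu> ?k"
    by (intro cond_ent_le_entropy simple_function_Pair k simple_coset simple_word_shift)
  also have "partition_entropy \<mu> ?k \<le> entropy_bound"
  proof (rule partition_entropy_le_ln_card[OF k _ finite_H])
    show "?k ` space \<mu> \<subseteq> H"
    proof safe
      fix x assume "x \<in> space \<mu>"
      then have g: "x 0 \<in> carrier G"
        by (simp add: space_eq)
      obtain h where h: "h \<in> H" "coset_rep (H #> x 0) = h \<otimes> x 0"
        using coset_rep_coset[OF g] by blast
      then have "?k x = inv h"
        using g H_carrier by (simp add: inv_mult_group m_assoc[symmetric])
      then show "?k x \<in> H"
        using h(1) by simp
    qed
  qed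
  also have "cond_ent ?Y ?W = cond_ent (\<lambda>x. coset_pred (shift x)) ?W"
    using coset_pred
    by (intro cond_ent_cong_AE simple_coset simple_word_shift
        simple_function_invariant[OF shift_invariant simple_coset_pred]) (auto simp: eq_commute)
  also have "\<dots> = cond_ent coset_pred (word n)"
    by (rule cond_ent_comp[OF invariant_underD[OF shift_invariant] simple_coset_pred simple_word])
  finally show ?thesis
    by simp
qed

section \<open>The automaton, the shift and left multiplication\<close>

lemma mult_ca_space: "x \<in> space \<mu> \<Longrightarrow> mult_ca G x \<in> space \<mu>"
  by (simp add: space_eq mult_ca_def)

lemma left_mult_space: "h \<in> H \<Longrightarrow> x \<in> space \<mu> \<Longrightarrow> left_mult_0 G h x \<in> space \<mu>"
  by (auto simp: space_eq left_mult_0_def H_carrier)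

lemma funpow_shift_mult_ca: "(shift ^^ n) (mult_ca G x) = mult_ca G ((shift ^^ n) x)"
  by (simp add: fun_eq_iff funpow_shift mult_ca_def)

lemma mult_ca_left_mult:
  "h \<in> H \<Longrightarrow> x \<in> space \<mu> \<Longrightarrow> mult_ca G (left_mult_0 G h x) = left_mult_0 G h (mult_ca G x)"
  by (auto simp: fun_eq_iff mult_ca_def left_mult_0_def space_eq H_carrier m_assoc)

text \<open>
  In the space-time diagram of \<open>mult_ca G\<close>, the bottom edge and the left edge of a triangle
  determine each other.
\<close>

lemma word_eq_iff_orbit_word_mult_ca:
  assumes "x \<in> space \<mu>" "y \<in> space \<mu>"
  shows "word n x = word n y \<longleftrightarrow> orbit_word (mult_ca G) (\<lambda>x. x 0) n x = orbit_word (mult_ca G) (\<lambda>x. x 0) n y"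
  using assms
proof (induction n arbitrary: x y)
  case 0
  show ?case by simp
next
  case (Suc n)
  let ?t = "mult_ca G"
  \<comment> \<open>Left cancellation recovers the row letter by letter from \<open>x 0\<close> and
    the first \<open>n\<close> letters of the next row.\<close>
  have "(\<forall>i<Suc n. x i = y i) \<longleftrightarrow> x 0 = y 0 \<and> (\<forall>i<n. ?t x i = ?t y i)"
  proof safe
    fix i assume xy: "x 0 = y 0" "\<forall>i<n. ?t x i = ?t y i" and i: "i < Suc n"
    from i show "x i = y i"
    proof (induction i)
      case (Suc i)
      then have "x i = y i"
        by simp
      moreover have "x i \<otimes> x (Suc i) = y i \<otimes> y (Suc i)"
        using xy(2) Suc(2) by (simp add: mult_ca_def)
      ultimately show ?case
        using \<open>x \<in> space \<mu>\<close> \<open>y \<in> space \<mu>\<close> by (simp add: space_eq)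
    qed (rule xy(1))
  qed (auto simp: mult_ca_def)
  then show ?case
    using Suc.IH[OF mult_ca_space mult_ca_space, OF Suc.prems]
    by (simp add: orbit_word_Suc[of "mult_ca G"] word_eq_iff)
qed

theorem left_mult_invariant_if_mult_ca_invariant:
  assumes P: "simple_function \<mu> P" and inv: "AE x in \<mu>. P (mult_ca G x) = P x" and h: "h \<in> H"
  shows "AE x in \<mu>. P (left_mult_0 G h x) = P x"
proof -
  let ?t = "mult_ca G"
  let ?Z = "orbit_word ?t (\<lambda>x. x 0)" and ?Q = "orbit_word shift P"
  let ?c = "\<lambda>j. cond_ent (\<lambda>x. x 0) (\<lambda>x. (word j (shift x), P x))"
  note Q = simple_function_orbit_word[OF invariant_underD(1)[OF shift_invariant] P]
  note Z = simple_function_orbit_word[OF invariant_underD(1)[OF ca_invariant] simple_coordinate]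
  have Q_inv: "AE x in \<mu>. ?Q n (?t x) = ?Q n x" for n
  proof -
    have "AE x in \<mu>. \<forall>i\<in>{..<n}. P (?t ((shift ^^ i) x)) = P ((shift ^^ i) x)"
      by (intro AE_finite_allI AE_invariant_under[OF invariant_under_funpow[OF shift_invariant] inv]) simp
    then show ?thesis
      by eventually_elim (simp add: orbit_word_def funpow_shift_mult_ca)
  qed
  have PE_Z: "partition_entropy \<mu> (?Z n) = partition_entropy \<mu> (word n)" for n
    by (rule partition_entropy_eq_pointwise[OF Z simple_word]) (simp add: word_eq_iff_orbit_word_mult_ca)
  \<comment> \<open>The column word \<open>?Z n\<close> has the entropy of the row word. As
    \<open>?Q n\<close> is constant along the column, conditioning on it preserves the linear lower
    bound, which then holds for the row word too since both words define the same partition.\<close>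
  have sum_ge: "real n * entropy_bound \<le> (\<Sum>j<n. ?c j)" for n
  proof -
    have "real n * entropy_bound \<le> cond_ent (?Z n) (?Q n)"
      using partition_entropy_word_ge
      by (intro cond_ent_orbit_word_invariant_ge[OF ca_invariant simple_coordinate Q Q_inv]) (simp add: PE_Z)
    also have "\<dots> = cond_ent (word n) (?Q n)"
      by (rule cond_ent_eq_pointwise[OF Z simple_word Q]) (simp add: word_eq_iff_orbit_word_mult_ca)
    also have "\<dots> \<le> (\<Sum>j<n. ?c j)"
      by (rule cond_ent_orbit_words_le_sum[OF shift_invariant simple_coordinate P])
    finally show ?thesis .
  qed
  have anti: "?c n \<le> ?c m" if "m \<le> n" for m n
    using that
    by (intro cond_ent_antimono simple_function_Pair simple_word_shift simple_coordinate P)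
       (auto simp: word_eq_iff)
  have c: "entropy_bound \<le> ?c j" for j
    by (rule le_if_le_sum_antimono[where c="?c"]) (erule anti, rule sum_ge)
  \<comment> \<open>The mutual information of \<open>x 0\<close> and \<open>P\<close> given
    \<open>?W\<close> is symmetric: the drop from \<open>cond_ent P ?W\<close> to
    \<open>cond_ent P (word (Suc j))\<close> equals the drop from the entropy of \<open>x 0\<close>
    given \<open>?W\<close> to \<open>?c j\<close>. The latter is at most
    \<open>cond_ent coset_pred (word j)\<close>, by the upper bound for \<open>x 0\<close> and the
    lower bound for \<open>?c j\<close>.\<close>
  have bound: "cond_ent P (\<lambda>x. word j (shift x)) \<le> cond_ent coset_pred (word j) + cond_ent P (word (Suc j))" for j
  proof -
    let ?W = "\<lambda>x. word j (shift x)"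
    note simp = simple_function_Pair simple_word_shift simple_coordinate P simple_word
    have "partition_entropy \<mu> (\<lambda>x. (P x, word (Suc j) x)) = partition_entropy \<mu> (\<lambda>x. (x 0, ?W x, P x))"
      by (intro partition_entropy_eq_pointwise simp) (auto simp: orbit_word_Suc)
    moreover have "partition_entropy \<mu> (word (Suc j)) = partition_entropy \<mu> (\<lambda>x. (x 0, ?W x))"
      by (intro partition_entropy_eq_pointwise simp) (auto simp: orbit_word_Suc)
    moreover have "partition_entropy \<mu> (\<lambda>x. (P x, ?W x)) = partition_entropy \<mu> (\<lambda>x. (?W x, P x))"
      by (intro partition_entropy_eq_pointwise simp) auto
    ultimately have "cond_ent P ?W = cond_ent (\<lambda>x. x 0) ?W - ?c j + cond_ent P (word (Suc j))"
      by (simp add: cond_ent_def)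
    then show ?thesis
      using c[of j] cond_ent_coordinate_le[of j] by simp
  qed
  have "(\<lambda>j. cond_ent P (\<lambda>x. word j (shift x))) \<longlonglongrightarrow> 0"
  proof (rule tendsto_sandwich[where f="\<lambda>_. 0"])
    show "(\<lambda>j. cond_ent coset_pred (word j) + cond_ent P (word (Suc j))) \<longlonglongrightarrow> 0"
      using tendsto_add[OF cond_ent_word_tendsto_0[OF simple_coset_pred]
          LIMSEQ_Suc[OF cond_ent_word_tendsto_0[OF P]]] by simp
    show "\<forall>\<^sub>F j in sequentially. 0 \<le> cond_ent P (\<lambda>x. word j (shift x))"
      by (intro always_eventually allI cond_ent_nonneg P simple_word_shift)
  qed (use bound in \<open>auto intro: always_eventually\<close>)
  \<comment> \<open>The words of the tail are fixed by \<open>left_mult_0 G h\<close> and determine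
    \<open>P\<close> asymptotically.\<close>
  then show ?thesis
    by (intro AE_comp_eq_if_cond_ent_small[OF invariant_underD[OF left_mult_invariant[OF h]] P simple_word_shift])
       simp
qed

end

section \<open>Cosets in the past\<close>

text \<open>Right multiplication with the inverse of one of its elements moves each fibre of
  \<open>D\<close> injectively into the kernel, so no fibre is larger than the kernel.\<close>

lemma (in group) card_le_card_kernel_mult:
  assumes G: "finite (carrier G)" and H: "subgroup H G" and E: "group E"
    and D: "\<And>h. h \<in> H \<Longrightarrow> D h \<in> carrier E"
    and D_mult: "\<And>h k. h \<in> H \<Longrightarrow> k \<in> H \<Longrightarrow> D (h \<otimes> k) = D h \<otimes>\<^bsub>E\<^esub> D k"
  shows "subgroup {h \<in> H. D h = \<one>\<^bsub>E\<^esub>} G" "card H \<le> card {h \<in> H. D h = \<one>\<^bsub>E\<^esub>} * card (D ` H)"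
proof -
  interpret H: subgroup H G by fact
  interpret E: group E by fact
  have one: "D \<one> = \<one>\<^bsub>E\<^esub>"
    using D_mult[of \<one> \<one>] D[of \<one>] by (simp add: E.r_cancel_one')
  have D_inv: "D (inv h) = inv\<^bsub>E\<^esub> D h" if "h \<in> H" for h
    using D_mult[of "inv h" h] D[OF that] D[of "inv h"] that one
    by (intro E.inv_equality[symmetric]) auto
  let ?K = "{h \<in> H. D h = \<one>\<^bsub>E\<^esub>}"
  show "subgroup ?K G"
    by (rule subgroupI) (use one in \<open>auto simp: D_inv D_mult intro: exI[of _ \<one>]\<close>)
  have fin: "finite H"
    using finite_subset[OF H.subset G] .
  have "card H = card (\<Union>d\<in>D ` H. {h \<in> H. D h = d})"
    by (intro arg_cong[where f=card]) auto
  also have "\<dots> = (\<Sum>d\<in>D ` H. card {h \<in> H. D h = d})"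
  proof (rule card_UN_disjoint)
    show "\<forall>i\<in>D ` H. \<forall>j\<in>D ` H. i \<noteq> j \<longrightarrow> {h \<in> H. D h = i} \<inter> {h \<in> H. D h = j} = {}"
      by blast
  qed (use fin in simp_all)
  also have "\<dots> \<le> (\<Sum>d\<in>D ` H. card ?K)"
  proof (rule sum_mono)
    fix d assume "d \<in> D ` H"
    then obtain k where k: "k \<in> H" "d = D k" by blast
    have "(\<lambda>h. h \<otimes> inv k) ` {h \<in> H. D h = d} \<subseteq> ?K"
    proof (rule image_subsetI)
      fix h assume "h \<in> {h \<in> H. D h = d}"
      then have h: "h \<in> H" "D h = d" by auto
      have "D (h \<otimes> inv k) = D k \<otimes>\<^bsub>E\<^esub> inv\<^bsub>E\<^esub> D k"
        using D_mult[of h "inv k"] D_inv[OF k(1)] h k by simp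
      then show "h \<otimes> inv k \<in> ?K"
        using D[OF k(1)] h(1) k(1) by simp
    qed
    moreover have "inj_on (\<lambda>h. h \<otimes> inv k) {h \<in> H. D h = d}"
      using k(1) H.subset by (intro inj_onI) (metis (no_types, lifting) H.mem_carrier inv_closed mem_Collect_eq right_cancel)
    ultimately show "card {h \<in> H. D h = d} \<le> card ?K"
      using fin by (intro card_inj_on_le) auto
  qed
  finally show "card H \<le> card ?K * card (D ` H)"
    by (simp add: mult.commute)
qed

lemma (in group) mult_right_inv_mult_right:
  assumes "a \<in> carrier G" "b \<in> carrier G" "c \<in> carrier G"
  shows "a \<otimes> b \<otimes> inv (c \<otimes> b) = a \<otimes> inv c"
proof -
  have "b \<otimes> (inv b \<otimes> inv c) = inv c"
    using assms by (simp add: m_assoc[symmetric])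
  then show ?thesis
    using assms by (simp add: inv_mult_group m_assoc)
qed

context coset_uniform_measure
begin

text \<open>
  The coset of the coordinate at index \<open>-k\<close> when \<open>x\<close> is extended to the left by \<open>coset_rep\<close> of the
  predicted cosets.
\<close>

primrec past_coset :: "nat \<Rightarrow> (nat \<Rightarrow> 'a) \<Rightarrow> 'a set" where
  "past_coset 0 = (\<lambda>x. H #> x 0)"
| "past_coset (Suc k) = (\<lambda>x. past_coset k (case_nat (coset_rep (coset_pred x)) x))"

lemma past_coset_rcosets: "x \<in> space \<mu> \<Longrightarrow> past_coset k x \<in> rcosets H"
proof (induction k arbitrary: x)
  case 0
  then show ?case
    using rcosetsI[OF H.subset] by (simp add: space_eq)
next
  case (Suc k)
  have "case_nat (coset_rep (coset_pred x)) x \<in> space \<mu>"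
    using Suc.prems coset_rep_carrier by (auto simp: space_eq split: nat.split)
  then show ?case
    using Suc.IH by simp
qed

lemma simple_past_coset: "simple_function \<mu> (past_coset k)"
proof (induction k)
  case 0
  show ?case
    using simple_coset[of 0] by simp
next
  case (Suc k)
  have rep: "(\<lambda>x. coset_rep (coset_pred x)) \<in> measurable \<mu> (count_space (carrier G))"
    by (intro measurable_count_space_simple coset_rep_carrier)
       (rule simple_function_compose1[OF simple_coset_pred])
  have "(\<lambda>x. case_nat (coset_rep (coset_pred x)) x) \<in> measurable \<mu> \<mu>"
  proof (rule measurable_muI)
    fix i
    show "(\<lambda>x. case_nat (coset_rep (coset_pred x)) x i) \<in> measurable \<mu> (count_space (carrier G))"
      by (cases i) (simp_all add: rep measurable_coordinate)
  qed
  from simple_function_comp[OF this Suc] show ?case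
    by simp
qed

text \<open>Extending \<open>shift x\<close> by the predicted representative restores
  \<open>x\<close> up to left multiplication of \<open>x 0\<close> by an element of
  \<open>H\<close>, which \<open>past_coset k\<close> does not notice.\<close>

lemma past_coset_Suc_shift:
  assumes "\<And>h. h \<in> H \<Longrightarrow> AE x in \<mu>. past_coset k (left_mult_0 G h x) = past_coset k x"
  shows "AE x in \<mu>. past_coset (Suc k) (shift x) = past_coset k x"
proof -
  have "AE x in \<mu>. \<forall>h\<in>H. past_coset k (left_mult_0 G h x) = past_coset k x"
    by (intro AE_H_all assms)
  then show ?thesis
    using coset_pred AE_space
  proof eventually_elim
    case (elim x)
    obtain h where h: "h \<in> H" "coset_rep (H #> x 0) = h \<otimes> x 0"
      using coset_rep_coset[of "x 0"] elim(3) by (auto simp: space_eq)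
    have "case_nat (coset_rep (coset_pred (shift x))) (shift x) = left_mult_0 G h x"
      unfolding elim(2) h(2) by (auto simp: fun_eq_iff left_mult_0_def shift_def split: nat.split)
    then show ?case
      using elim(1) h(1) by simp
  qed
qed

text \<open>
  The ratio \<open>D h x\<close> of the values of \<open>past_coset (Suc k)\<close> at \<open>left_mult_0 G h x\<close> and \<open>x\<close> is
  invariant under \<open>mult_ca G\<close>, hence under \<open>left_mult_0\<close>. This makes \<open>h \<mapsto> D h x\<close> a homomorphism
  from \<open>H\<close> to \<open>G Mod H\<close>, whose kernel is too large to be a proper subgroup.
\<close>

lemma past_coset_left_mult_step:
  assumes small: "\<And>K. subgroup K G \<Longrightarrow> K \<subset> H \<Longrightarrow> card K * card (rcosets H) < card H"
    and inv_k: "\<And>h. h \<in> H \<Longrightarrow> AE x in \<mu>. past_coset k (left_mult_0 G h x) = past_coset k x"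
    and k: "AE x in \<mu>. past_coset k ((shift ^^ k) x) = H #> x 0"
    and Suc_k: "AE x in \<mu>. past_coset (Suc k) ((shift ^^ Suc k) x) = H #> x 0"
    and h: "h \<in> H"
  shows "AE x in \<mu>. past_coset (Suc k) (left_mult_0 G h x) = past_coset (Suc k) x"
proof -
  interpret E: group "G Mod H"
    by (rule H.factorgroup_is_group)
  define F where "F = past_coset k"
  define F' where "F' = past_coset (Suc k)"
  let ?E = "G Mod H" and ?t = "mult_ca G"
  have simple: "simple_function \<mu> F" "simple_function \<mu> F'"
    unfolding F_def F'_def by (rule simple_past_coset)+
  have carr: "F x \<in> carrier ?E" "F' x \<in> carrier ?E" if "x \<in> space \<mu>" for x
    using past_coset_rcosets[OF that] unfolding F_def F'_def by (simp_all add: FactGroup_def del: past_coset.simps)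
  \<comment> \<open>Seen from index \<open>Suc k\<close>, \<open>F'\<close> is the coset of
    \<open>x 0\<close> and \<open>F\<close> that of \<open>x 1\<close>, so the automaton multiplies
    \<open>F'\<close> by \<open>F\<close> on the right.\<close>
  have "AE x in \<mu>. F' (?t ((shift ^^ Suc k) x)) = F' ((shift ^^ Suc k) x) <#> F ((shift ^^ Suc k) x)"
    using AE_invariant_under[OF ca_invariant Suc_k] AE_invariant_under[OF shift_invariant k] Suc_k AE_space
  proof eventually_elim
    case (elim x)
    have "F' (?t ((shift ^^ Suc k) x)) = H #> ?t x 0"
      using elim(1) unfolding F'_def funpow_shift_mult_ca .
    also have "\<dots> = (H #> x 0) <#> (H #> x 1)"
      using elim(4) by (simp add: mult_ca_def H.rcos_sum space_eq)
    also have "H #> x 1 = F ((shift ^^ Suc k) x)"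
      using elim(2) by (simp add: F_def shift_def[of x] funpow_swap1)
    finally show ?case
      using elim(3) by (simp add: F'_def del: past_coset.simps funpow.simps)
  qed
  \<comment> \<open>Invariance of the measure removes the shift from this almost sure
    identity.\<close>
  then have F'_ca: "AE x in \<mu>. F' (?t x) = F' x <#> F x"
    using AE_comp_iff_simple[OF invariant_under_funpow[OF shift_invariant, of "Suc k"]
        simple_function_Pair[OF simple_function_invariant[OF ca_invariant simple(2)]
          simple_function_Pair[OF simple(2,1)]],
        where P="\<lambda>(a, b, c). a = b <#> c"] by (simp del: funpow.simps)
  define D where "D h x = F' (left_mult_0 G h x) \<otimes>\<^bsub>?E\<^esub> inv\<^bsub>?E\<^esub> F' x" for h x
  have D_inv: "AE x in \<mu>. D h (left_mult_0 G h' x) = D h x" if h: "h \<in> H" and h': "h' \<in> H" for h h'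
  proof (rule left_mult_invariant_if_mult_ca_invariant[OF _ _ h'])
    show "simple_function \<mu> (D h)"
      unfolding D_def
      by (intro simple_function_compose2[of \<mu> _ _ "\<lambda>a b. a \<otimes>\<^bsub>?E\<^esub> inv\<^bsub>?E\<^esub> b"]
          simple_function_invariant[OF left_mult_invariant[OF h]] simple)
    \<comment> \<open>The automaton contributes the right factor \<open>F\<close> to both terms of
      the ratio. It is the same at \<open>x\<close> and at \<open>left_mult_0 G h x\<close> by
      \<open>inv_k\<close>, hence cancels.\<close>
    show "AE x in \<mu>. D h (?t x) = D h x"
      using F'_ca AE_invariant_under[OF left_mult_invariant[OF h] F'_ca] inv_k[OF h] AE_space
    proof eventually_elim
      case (elim x)
      note c = carr[OF elim(4)] carr[OF left_mult_space[OF h elim(4)]]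
      have "D h (?t x) = F' (?t (left_mult_0 G h x)) \<otimes>\<^bsub>?E\<^esub> inv\<^bsub>?E\<^esub> F' (?t x)"
        by (simp add: D_def mult_ca_left_mult[OF h elim(4)])
      also have "\<dots> = (F' (left_mult_0 G h x) \<otimes>\<^bsub>?E\<^esub> F x) \<otimes>\<^bsub>?E\<^esub> inv\<^bsub>?E\<^esub> (F' x \<otimes>\<^bsub>?E\<^esub> F x)"
        using elim(1-3) by (simp add: F_def)
      also have "\<dots> = D h x"
        unfolding D_def using c by (intro E.mult_right_inv_mult_right)
      finally show ?case .
    qed
  qed
  have "AE x in \<mu>. \<forall>h\<in>H. \<forall>h'\<in>H. D h (left_mult_0 G h' x) = D h x"
    by (intro AE_H_all D_inv)
  then have "AE x in \<mu>. F' (left_mult_0 G h x) = F' x"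
    using AE_space
  proof eventually_elim
    case (elim x)
    have D_carrier: "D k x \<in> carrier ?E" if "k \<in> H" for k
      using carr(2)[OF elim(2)] carr(2)[OF left_mult_space[OF that elim(2)]] by (simp only: D_def E.m_closed E.inv_closed)
    \<comment> \<open>In general \<open>D\<close> satisfies the cocycle identity, with
      \<open>D k\<close> evaluated at \<open>left_mult_0 G k' x\<close>; invariance of
      \<open>D k\<close> replaces that point by \<open>x\<close>.\<close>
    have D_mult: "D (k \<otimes> k') x = D k x \<otimes>\<^bsub>?E\<^esub> D k' x" if k: "k \<in> H" and k': "k' \<in> H" for k k'
    proof -
      note s = left_mult_space[OF k' elim(2)]
      note c = carr(2)[OF elim(2)] carr(2)[OF s] carr(2)[OF left_mult_space[OF k s]]
      have "left_mult_0 G (k \<otimes> k') x = left_mult_0 G k (left_mult_0 G k' x)"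
        using k k' elim(2) by (auto simp: left_mult_0_def space_eq H_carrier m_assoc)
      then have "D (k \<otimes> k') x = F' (left_mult_0 G k (left_mult_0 G k' x)) \<otimes>\<^bsub>?E\<^esub> inv\<^bsub>?E\<^esub> F' x"
        by (simp add: D_def)
      also have "\<dots> = D k (left_mult_0 G k' x) \<otimes>\<^bsub>?E\<^esub> D k' x"
        using c unfolding D_def
        by (metis E.inv_closed E.inv_solve_right E.m_assoc E.m_closed)
      finally show ?thesis
        using elim(1) k k' by simp
    qed
    let ?K = "{k \<in> H. D k x = \<one>\<^bsub>?E\<^esub>}"
    note K = card_le_card_kernel_mult[OF finite_carrier H.is_subgroup H.factorgroup_is_group, of "\<lambda>k. D k x", OF D_carrier D_mult]
    have "card H \<le> card ?K * card (rcosets H)"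
    proof -
      have "card ((\<lambda>k. D k x) ` H) \<le> card (rcosets H)"
      proof (rule card_mono)
        show "finite (rcosets H)"
          using finite_carrier by (simp add: RCOSETS_def)
        show "(\<lambda>k. D k x) ` H \<subseteq> rcosets H"
          using D_carrier by (auto simp: FactGroup_def)
      qed
      then show ?thesis
        using K(2) by (meson le_trans mult_le_mono2)
    qed
    then have "\<not> ?K \<subset> H"
      using small[OF K(1)] by linarith
    then have "D h x = \<one>\<^bsub>?E\<^esub>"
      using h by blast
    then show ?case
      using carr(2)[OF elim(2)] carr(2)[OF left_mult_space[OF h elim(2)]] unfolding D_def
      by (metis E.inv_equality E.inv_inv E.inv_closed)
  qed
  then show ?thesis
    by (simp only: F'_def)
qed

text \<open>The induction also carries that \<open>past_coset k\<close>, seen from index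
  \<open>k\<close>, is the true coset at index 0. The step needs this to compute how the automaton
  acts on \<open>past_coset\<close>.\<close>

lemma past_coset_left_mult:
  assumes small: "\<And>K. subgroup K G \<Longrightarrow> K \<subset> H \<Longrightarrow> card K * card (rcosets H) < card H" and h: "h \<in> H"
  shows "AE x in \<mu>. past_coset k (left_mult_0 G h x) = past_coset k x"
proof -
  have "(\<forall>h\<in>H. AE x in \<mu>. past_coset k (left_mult_0 G h x) = past_coset k x)
      \<and> (AE x in \<mu>. past_coset k ((shift ^^ k) x) = H #> x 0)"
  proof (induction k)
    case 0
    show ?case
      by (auto simp: coset_left_mult space_eq intro!: AE_I2)
  next
    case (Suc k)
    then have inv_k: "\<And>h. h \<in> H \<Longrightarrow> AE x in \<mu>. past_coset k (left_mult_0 G h x) = past_coset k x"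
      and k: "AE x in \<mu>. past_coset k ((shift ^^ k) x) = H #> x 0"
      by blast+
    have "AE x in \<mu>. past_coset (Suc k) (shift x) = past_coset k x"
      by (rule past_coset_Suc_shift[OF inv_k])
    from AE_invariant_under[OF invariant_under_funpow[OF shift_invariant, of k] this] k
    have Suc_k: "AE x in \<mu>. past_coset (Suc k) ((shift ^^ Suc k) x) = H #> x 0"
      by eventually_elim simp
    from past_coset_left_mult_step[OF small inv_k k Suc_k] show ?case
      using Suc_k by blast
  qed
  then show ?thesis
    using h by blast
qed

text \<open>The coset sequence of the left extension, started \<open>k\<close> places before index
  0. Shifting the point while raising \<open>k\<close> by one leaves it almost surely
  unchanged.\<close>

definition extended_cosets :: "nat \<Rightarrow> (nat \<Rightarrow> 'a) \<Rightarrow> nat \<Rightarrow> 'a set" where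
  "extended_cosets k x j = (if j < k then past_coset (k - j) x else H #> x (j - k))"

lemma measurable_extended_cosets: "extended_cosets k \<in> measurable \<mu> (full_shift (Pow (carrier G)))"
proof (rule measurable_full_shiftI)
  fix j
  have carrier: "L \<in> rcosets H \<Longrightarrow> L \<in> Pow (carrier G)" for L
    using H.rcosets_carrier[OF is_group] by blast
  show "(\<lambda>x. extended_cosets k x j) \<in> measurable \<mu> (count_space (Pow (carrier G)))"
  proof (cases "j < k")
    case True
    then show ?thesis
      using measurable_count_space_simple[OF simple_past_coset, where A="Pow (carrier G)"] carrier[OF past_coset_rcosets]
      by (simp add: extended_cosets_def)
  next
    case False
    then show ?thesis
      using measurable_count_space_simple[OF simple_coset, where A="Pow (carrier G)"] carrier[OF rcosetsI[OF H.subset]]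
      by (simp add: extended_cosets_def space_eq)
  qed
qed

text \<open>
  A function of the coset sequence is, after changing it on a null set, a function of \<open>(shift ^^ n) x\<close>
  for every \<open>n\<close>, so it is independent of the noise inside the cosets.
\<close>

lemma cond_ent_word_extended_cosets_ge:
  assumes small: "\<And>K. subgroup K G \<Longrightarrow> K \<subset> H \<Longrightarrow> card K * card (rcosets H) < card H"
    and X: "simple_function (full_shift (Pow (carrier G))) X"
  shows "real n * entropy_bound \<le> cond_ent (word n) (\<lambda>x. X (extended_cosets k x))"
\<comment> \<open>\<open>k\<close> varies because the tail of the word belongs to
  \<open>shift x\<close>, for which the same coset sequence is
  \<open>extended_cosets (Suc k)\<close>.\<close>
proof (induction n arbitrary: k)
  case 0
  have "0 \<le> cond_ent (word 0) (\<lambda>x. X (extended_cosets k x))"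
    by (intro cond_ent_nonneg simple_word simple_function_comp[OF measurable_extended_cosets X])
  then show ?case
    by (simp del: orbit_word_0)
next
  case (Suc n)
  let ?R = "\<lambda>k x. X (extended_cosets k x)"
  have R: "simple_function \<mu> (?R k)" for k
    by (rule simple_function_comp[OF measurable_extended_cosets X])
  have R_shift: "AE x in \<mu>. ?R k x = ?R (Suc k) (shift x)"
  proof -
    have "AE x in \<mu>. \<forall>j. past_coset (Suc j) (shift x) = past_coset j x"
      by (subst AE_all_countable) (intro allI past_coset_Suc_shift past_coset_left_mult[OF small])
    then show ?thesis
    proof eventually_elim
      case (elim x)
      have "extended_cosets (Suc k) (shift x) j = extended_cosets k x j" for j
      proof (cases "j < Suc k")
        case True
        then have "extended_cosets (Suc k) (shift x) j = past_coset (k - j) x"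
          using elim by (simp add: extended_cosets_def Suc_diff_le del: past_coset.simps)
        then show ?thesis
          using True by (cases "j = k") (auto simp: extended_cosets_def)
      next
        case False
        then show ?thesis
          by (simp add: extended_cosets_def shift_def Suc_diff_Suc)
      qed
      then show ?case
        by presburger
    qed
  qed
  have R_inv: "AE x in \<mu>. ?R k (left_mult_0 G h x) = ?R k x" if h: "h \<in> H" for h
  proof -
    have "AE x in \<mu>. \<forall>j. past_coset j (left_mult_0 G h x) = past_coset j x"
      by (subst AE_all_countable) (intro allI past_coset_left_mult[OF small] h)
    then show ?thesis
      using AE_space
    proof eventually_elim
      case (elim x)
      have "H #> left_mult_0 G h x i = H #> x i" for i
        using elim(2) h by (auto simp: left_mult_0_def coset_left_mult space_eq)
      then have "extended_cosets k (left_mult_0 G h x) = extended_cosets k x"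
        using elim(1) by (simp add: extended_cosets_def fun_eq_iff)
      then show ?case
        by simp
    qed
  qed
  have "real n * entropy_bound \<le> cond_ent (word n) (?R (Suc k))"
    by (rule Suc)
  also have "\<dots> = cond_ent (\<lambda>x. word n (shift x)) (\<lambda>x. ?R (Suc k) (shift x))"
    by (rule cond_ent_comp[OF invariant_underD[OF shift_invariant] simple_word R, symmetric])
  also have "\<dots> = cond_ent (\<lambda>x. word n (shift x)) (?R k)"
    using R_shift
    by (intro cond_ent_cong_AE simple_word_shift simple_function_invariant[OF shift_invariant R] R) (auto simp: eq_commute)
  finally have "real n * entropy_bound \<le> cond_ent (\<lambda>x. word n (shift x)) (?R k)" .
  moreover have "entropy_bound \<le> cond_ent (\<lambda>x. x 0) (\<lambda>x. (word n (shift x), ?R k x))"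
    by (rule cond_ent_coordinate_ge[OF R R_inv])
  moreover have "cond_ent (word (Suc n)) (?R k)
      = cond_ent (\<lambda>x. word n (shift x)) (?R k) + cond_ent (\<lambda>x. x 0) (\<lambda>x. (word n (shift x), ?R k x))"
    by (rule cond_ent_chain[OF simple_coordinate simple_word_shift R simple_word]) (simp add: orbit_word_Suc)
  ultimately show ?case
    by (simp add: algebra_simps)
qed

text \<open>Counterpart to \<open>partition_entropy_word_ge\<close>: the terms of the sum tend to 0,
  so the words have entropy rate exactly \<open>entropy_bound\<close>.\<close>

lemma partition_entropy_word_le:
  "partition_entropy \<mu> (word n) \<le> real n * entropy_bound + (\<Sum>j<n. cond_ent coset_pred (word j))"
proof (induction n)
  case 0
  have "partition_entropy \<mu> (word 0) \<le> ln (card {[] :: 'a list})"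
    by (rule partition_entropy_le_ln_card[OF simple_word]) auto
  then show ?case
    by (simp del: orbit_word_0)
next
  case (Suc n)
  then show ?case
    using partition_entropy_orbit_word_Suc[OF shift_invariant simple_coordinate[of 0], of n] cond_ent_coordinate_le[of n]
    by (simp add: algebra_simps)
qed

theorem entropy_coset_process_tendsto_0:
  assumes small: "\<And>K. subgroup K G \<Longrightarrow> K \<subset> H \<Longrightarrow> card K * card (rcosets H) < card H"
    and X: "simple_function (full_shift (Pow (carrier G))) X"
  shows "(\<lambda>n. partition_entropy \<mu> (\<lambda>x. orbit_word shift X n (\<lambda>i. H #> x i)) / real n) \<longlonglongrightarrow> 0"
proof -
  define P where "P x = X (\<lambda>i. H #> x i)" for x
  have ext0: "extended_cosets 0 x = (\<lambda>i. H #> x i)" for x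
    by (simp add: extended_cosets_def fun_eq_iff)
  have P: "simple_function \<mu> P"
    using simple_function_comp[OF measurable_extended_cosets[of 0] X] by (simp add: P_def[abs_def] ext0)
  have Q: "orbit_word shift X n (\<lambda>i. H #> x i) = orbit_word shift P n x" for n x
    by (simp add: orbit_word_def P_def funpow_shift[abs_def])
  have simple_Q: "simple_function \<mu> (orbit_word shift P n)" for n
    by (rule simple_function_orbit_word[OF invariant_underD(1)[OF shift_invariant] P])
  let ?e = "\<lambda>j. cond_ent coset_pred (word j) + cond_ent P (word (Suc j))"
  \<comment> \<open>The entropy of the label word is that of \<open>word n\<close>, plus its own
    conditional entropy given \<open>word n\<close>, minus the conditional entropy of
    \<open>word n\<close> given it. The linear terms of the first and the last cancel.\<close>
  have le: "partition_entropy \<mu> (orbit_word shift P n) \<le> (\<Sum>j<n. ?e j)" for n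
  proof -
    have shift_full: "shift \<in> measurable (full_shift (Pow (carrier G))) (full_shift (Pow (carrier G)))"
      using measurable_full_shift_coordinate by (intro measurable_full_shiftI) (simp add: shift_def)
    \<comment> \<open>The lower bound is applied with \<open>k = 0\<close> to the whole word of
      \<open>n\<close> labels as one finite-valued function of the coset sequence.\<close>
    have "real n * entropy_bound \<le> cond_ent (word n) (orbit_word shift P n)"
      using cond_ent_word_extended_cosets_ge[OF small simple_function_orbit_word[OF shift_full X], of n n 0]
      by (simp add: ext0 Q)
    moreover have "partition_entropy \<mu> (\<lambda>x. (word n x, orbit_word shift P n x))
        = partition_entropy \<mu> (\<lambda>x. (orbit_word shift P n x, word n x))"
      by (intro partition_entropy_eq_pointwise simple_function_Pair simple_word simple_Q) auto
    ultimately show ?thesis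
      using partition_entropy_word_le[of n] cond_ent_orbit_word_le_sum[OF shift_invariant simple_coordinate[of 0] P, of n]
      by (simp add: cond_ent_def sum.distrib)
  qed
  have "?e \<longlonglongrightarrow> 0"
    using tendsto_add[OF cond_ent_word_tendsto_0[OF simple_coset_pred]
        LIMSEQ_Suc[OF cond_ent_word_tendsto_0[OF P]]] by simp
  from Cesaro_null[OF this]
  have "(\<lambda>n. partition_entropy \<mu> (orbit_word shift P n) / real n) \<longlonglongrightarrow> 0"
  proof (rule tendsto_sandwich[where f="\<lambda>_. 0", rotated 3])
    show "\<forall>\<^sub>F n in sequentially. 0 \<le> partition_entropy \<mu> (orbit_word shift P n) / real n"
      by (intro always_eventually allI divide_nonneg_nonneg partition_entropy_nonneg simple_Q) simp
    show "\<forall>\<^sub>F n in sequentially. partition_entropy \<mu> (orbit_word shift P n) / real n \<le> (\<Sum>j<n. ?e j) / real n"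
      by (intro always_eventually allI divide_right_mono le) simp
  qed simp
  then show ?thesis
    by (simp add: Q)
qed

end

section \<open>The conditional measures\<close>

context normal_shift_measure
begin

lemma card_H_pos: "0 < card H"
  using finite_H H.one_closed by (metis card_gt_0_iff empty_iff)

section \<open>Conditional probabilities given the tail\<close>

abbreviation past_algebra :: "(nat \<Rightarrow> 'a) measure" where
  "past_algebra \<equiv> vimage_algebra (space \<mu>) shift \<mu>"

text \<open>The density of \<open>cond_measure\<close> before its conversion to
  \<open>ennreal\<close>.\<close>

definition past_prob :: "'a \<Rightarrow> (nat \<Rightarrow> 'a) \<Rightarrow> real" where
  "past_prob g = real_cond_exp \<mu> past_algebra (indicator {y \<in> space \<mu>. y 0 = g})"

lemma shift_in_space: "shift \<in> space \<mu> \<rightarrow> space \<mu>"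
  using measurable_invariant_space[OF shift_invariant] by blast

lemma sets_past_algebra: "sets past_algebra = {shift -` A \<inter> space \<mu> | A. A \<in> sets \<mu>}"
  by (rule sets_vimage_algebra2[OF shift_in_space])

lemma subalgebra_past_algebra: "subalgebra \<mu> past_algebra"
  using measurable_sets[OF invariant_underD(1)[OF shift_invariant]]
  by (auto simp: subalgebra_def sets_past_algebra)

sublocale past: finite_measure_subalgebra \<mu> past_algebra
  by unfold_locales (rule subalgebra_past_algebra)

lemma measurable_past_prob: "past_prob g \<in> borel_measurable past_algebra"
  unfolding past_prob_def by (rule borel_measurable_cond_exp)

lemma measurable_past_prob': "past_prob g \<in> borel_measurable \<mu>"
  unfolding past_prob_def by (rule borel_measurable_cond_exp2)

lemma sets_coordinate_eq: "{x \<in> space \<mu>. x i = g} \<in> sets \<mu>"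
  by (rule sets_simple_eq[OF simple_coordinate])

lemma integrable_coordinate_eq: "integrable \<mu> (indicator {x \<in> space \<mu>. x i = g} :: _ \<Rightarrow> real)"
  using sets_coordinate_eq by (simp add: less_top[symmetric])

lemma set_integral_past_prob:
  assumes A: "A \<in> sets past_algebra"
  shows "(\<integral>x\<in>A. past_prob g x \<partial>\<mu>) = prob (A \<inter> {x \<in> space \<mu>. x 0 = g})"
proof -
  have "A \<in> sets \<mu>"
    using A subalgebra_past_algebra by (auto simp: subalgebra_def)
  then have "A \<inter> {x \<in> space \<mu>. x 0 = g} \<in> sets \<mu>"
    using sets_coordinate_eq by blast
  moreover have "indicator A x *\<^sub>R indicator {x \<in> space \<mu>. x 0 = g} x
      = (indicator (A \<inter> {x \<in> space \<mu>. x 0 = g}) x :: real)" for x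
    by (simp add: indicator_inter_arith)
  ultimately have "(\<integral>x\<in>A. indicator {x \<in> space \<mu>. x 0 = g} x \<partial>\<mu>) = prob (A \<inter> {x \<in> space \<mu>. x 0 = g})"
    by (simp add: set_lebesgue_integral_def)
  then show ?thesis
    using past.real_cond_exp_intA[OF integrable_coordinate_eq A] by (simp add: past_prob_def)
qed

lemma AE_past_prob_nonneg: "AE x in \<mu>. 0 \<le> past_prob g x"
  unfolding past_prob_def
  by (rule past.real_cond_exp_pos) (use borel_measurable_integrable[OF integrable_coordinate_eq] in auto)

section \<open>Uniform conditional measures on right cosets\<close>

lemma rcoset_subset: "subgroup K G \<Longrightarrow> L \<in> rcosets K \<Longrightarrow> L \<subseteq> carrier G"
  using subgroup.rcosets_carrier[OF _ is_group] .

lemma rcoset_nonempty: "subgroup K G \<Longrightarrow> L \<in> rcosets K \<Longrightarrow> L \<noteq> {}"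
  using subgroup.rcosets_non_empty by blast

lemma rcoset_card_pos: "subgroup K G \<Longrightarrow> L \<in> rcosets K \<Longrightarrow> 0 < card L"
  using rcoset_subset rcoset_nonempty finite_subset[OF _ finite_carrier] card_gt_0_iff by metis

text \<open>Both measures have densities on a finite set, which can be compared point by point. The
  comparison stays in \<open>ennreal\<close> because \<open>past_prob\<close> is nonnegative only
  almost surely.\<close>

lemma cond_uniform_on_iff:
  "cond_uniform_on G \<mu> x K L \<longleftrightarrow> subgroup K G \<and> L \<in> rcosets K
    \<and> (\<forall>g\<in>carrier G. ennreal (past_prob g x) = ennreal (indicator L g / real (card L)))"
proof -
  have "cond_measure G \<mu> x = uniform_measure (count_space (carrier G)) L
      \<longleftrightarrow> (\<forall>g\<in>carrier G. ennreal (past_prob g x) = ennreal (indicator L g / real (card L)))"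
    if K: "subgroup K G" and L: "L \<in> rcosets K"
  proof -
    note L' = rcoset_subset[OF K L] rcoset_card_pos[OF K L]
    have "finite L"
      using L'(1) finite_carrier by (rule finite_subset)
    then have card: "emeasure (count_space (carrier G)) L = ennreal (real (card L))"
      using L'(1) by (simp add: emeasure_count_space_finite ennreal_of_nat_eq_real_of_nat)
    have div: "indicator L g / ennreal (real (card L)) = ennreal (indicator L g / real (card L))" for g
      using L'(2) divide_ennreal[of 1 "real (card L)"] by (cases "g \<in> L") auto
    have cm: "cond_measure G \<mu> x = point_measure (carrier G) (\<lambda>g. ennreal (past_prob g x))"
      by (simp add: cond_measure_def past_prob_def)
    have um: "uniform_measure (count_space (carrier G)) L
        = point_measure (carrier G) (\<lambda>g. ennreal (indicator L g / real (card L)))"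
      by (simp add: uniform_measure_def point_measure_def card div)
    have "point_measure (carrier G) p = point_measure (carrier G) q \<longleftrightarrow> (\<forall>g\<in>carrier G. p g = q g)"
      for p q :: "'a \<Rightarrow> ennreal"
    proof
      assume eq: "point_measure (carrier G) p = point_measure (carrier G) q"
      have "r g = emeasure (point_measure (carrier G) r) {g}" if "g \<in> carrier G" for g and r :: "'a \<Rightarrow> ennreal"
        using that by (simp add: emeasure_point_measure_finite[OF finite_carrier])
      then show "\<forall>g\<in>carrier G. p g = q g"
        using eq by metis
    next
      assume "\<forall>g\<in>carrier G. p g = q g"
      then show "point_measure (carrier G) p = point_measure (carrier G) q"
        unfolding point_measure_def by (intro density_cong) (auto simp: AE_count_space)
    qed
    then show ?thesis
      by (simp only: cm um)
  qed
  then show ?thesis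
    by (auto simp: cond_uniform_on_def)
qed

lemma cond_uniform_on_support:
  assumes "cond_uniform_on G \<mu> x K L"
  shows "L = {g \<in> carrier G. ennreal (past_prob g x) \<noteq> 0}"
proof -
  note u = assms[unfolded cond_uniform_on_iff]
  have "0 < card L" "L \<subseteq> carrier G"
    using u rcoset_card_pos rcoset_subset by blast+
  moreover have "ennreal (past_prob g x) \<noteq> 0 \<longleftrightarrow> g \<in> L" if "g \<in> carrier G" for g
  proof -
    have "ennreal (past_prob g x) \<noteq> 0 \<longleftrightarrow> ennreal (indicator L g / real (card L)) \<noteq> 0"
      using u that by simp
    also have "\<dots> \<longleftrightarrow> g \<in> L"
      using \<open>0 < card L\<close> by (simp add: indicator_def ennreal_eq_0_iff)
    finally show ?thesis .
  qed
  ultimately show ?thesis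
    by blast
qed

text \<open>The coset is the support of the measure, and right division by one of its elements
  recovers the subgroup from it.\<close>

lemma cond_uniform_on_unique:
  assumes u: "cond_uniform_on G \<mu> x K L" "cond_uniform_on G \<mu> x K' L'"
  shows "K = K'" "L = L'"
proof -
  show L: "L = L'"
    using cond_uniform_on_support[OF u(1)] cond_uniform_on_support[OF u(2)] by simp
  have sub: "J \<subseteq> J'"
    if J: "subgroup J G" "L \<in> rcosets J" and J': "subgroup J' G" "L \<in> rcosets J'" for J J'
  proof
    fix j assume j: "j \<in> J"
    obtain a where a: "a \<in> carrier G" "L = J #> a"
      using J(2) by (auto simp: RCOSETS_def)
    have "a \<in> L"
      using a rcos_self J(1) by blast
    then have "L = J' #> a"
      using J' repr_independence by (auto simp: RCOSETS_def)
    moreover have "j \<otimes> a \<in> L"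
      using j a by (auto simp: r_coset_def)
    ultimately obtain j' where "j' \<in> J'" "j \<otimes> a = j' \<otimes> a"
      by (auto simp: r_coset_def)
    then show "j \<in> J'"
      using a(1) j subgroup.mem_carrier[OF J(1)] subgroup.mem_carrier[OF J'(1)] by simp
  qed
  show "K = K'"
    using sub[of K K'] sub[of K' K] u L by (auto simp: cond_uniform_on_def)
qed

lemma cond_coset_eq:
  assumes "cond_uniform_on G \<mu> x K L"
  shows "cond_coset G \<mu> x = L" "cond_subgroup G \<mu> x = K"
proof -
  have "(THE L. \<exists>K. cond_uniform_on G \<mu> x K L) = L"
    using assms by (intro the_equality) (auto dest: cond_uniform_on_unique(2))
  then show "cond_coset G \<mu> x = L"
    using assms by (auto simp: cond_coset_def)
  have "(THE K. \<exists>L. cond_uniform_on G \<mu> x K L) = K"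
    using assms by (intro the_equality) (auto dest: cond_uniform_on_unique(1))
  then show "cond_subgroup G \<mu> x = K"
    using assms by (auto simp: cond_subgroup_def)
qed

text \<open>The empty set is excluded because it is the default value of
  \<open>cond_coset\<close>.\<close>

lemma cond_coset_eq_iff:
  assumes "L \<noteq> {}"
  shows "cond_coset G \<mu> x = L \<longleftrightarrow> (\<exists>K. cond_uniform_on G \<mu> x K L)"
  using cond_coset_eq(1) assms by (metis cond_coset_def)

lemma cond_coset_subset: "cond_coset G \<mu> x \<in> Pow (carrier G)"
proof (cases "cond_coset G \<mu> x = {}")
  case False
  then obtain K where "cond_uniform_on G \<mu> x K (cond_coset G \<mu> x)"
    using cond_coset_eq_iff by blast
  then show ?thesis
    using rcoset_subset by (auto simp: cond_uniform_on_def)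
qed simp

lemma measurable_cond_coset: "cond_coset G \<mu> \<in> measurable \<mu> (count_space (Pow (carrier G)))"
proof -
  have fin: "finite (Pow (carrier G))"
    using finite_carrier by simp
  have nonempty: "{x \<in> space \<mu>. cond_coset G \<mu> x = L} \<in> sets \<mu>" if "L \<noteq> {}" for L
  proof (cases "\<exists>K. subgroup K G \<and> L \<in> rcosets K")
    case True
    \<comment> \<open>Whether \<open>L\<close> is a right coset of some subgroup does not depend on
      \<open>x\<close>; what remains are finitely many conditions on the measurable functions
      \<open>past_prob g\<close>.\<close>
    have "{x \<in> space \<mu>. cond_coset G \<mu> x = L} = {x \<in> space \<mu>.
        \<forall>g\<in>carrier G. ennreal (past_prob g x) = ennreal (indicator L g / real (card L))}"
      using True by (auto simp: cond_coset_eq_iff[OF that] cond_uniform_on_iff)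
    also have "\<dots> \<in> sets \<mu>"
      using measurable_past_prob' by (intro sets.sets_Collect_finite_All finite_carrier) measurable
    finally show ?thesis .
  next
    case False
    then have "{x \<in> space \<mu>. cond_coset G \<mu> x = L} = {}"
      by (auto simp: cond_coset_eq_iff[OF that] cond_uniform_on_def)
    also have "\<dots> \<in> sets \<mu>"
      by simp
    finally show ?thesis .
  qed
  moreover have "{x \<in> space \<mu>. cond_coset G \<mu> x = {}}
      = space \<mu> - (\<Union>L\<in>Pow (carrier G) - {{}}. {x \<in> space \<mu>. cond_coset G \<mu> x = L})"
    using cond_coset_subset by auto
  moreover have "space \<mu> - (\<Union>L\<in>Pow (carrier G) - {{}}. {x \<in> space \<mu>. cond_coset G \<mu> x = L}) \<in> sets \<mu>"
    using fin by (intro sets.Diff sets.top sets.finite_UN nonempty) auto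
  ultimately have "{x \<in> space \<mu>. cond_coset G \<mu> x = L} \<in> sets \<mu>" for L
    by (cases "L = {}") simp_all
  then show ?thesis
    unfolding measurable_count_space_eq2[OF fin] vimage_singleton_space
    by (intro conjI funcsetI ballI cond_coset_subset)
qed

lemma measurable_coset_map: "coset_map G \<mu> \<in> measurable \<mu> (full_shift (Pow (carrier G)))"
  unfolding coset_map_def
  by (rule measurable_full_shiftI)
     (rule measurable_compose[OF invariant_underD(1)[OF invariant_under_funpow[OF shift_invariant]] measurable_cond_coset])

section \<open>Consequences of an almost surely constant subgroup\<close>

context
  assumes AE_cond_subgroup: "AE x in \<mu>. cond_subgroup G \<mu> x = H"
begin

lemma AE_cond_uniform_on: "AE x in \<mu>. cond_uniform_on G \<mu> x H (cond_coset G \<mu> x)"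
  using AE_cond_subgroup
proof eventually_elim
  case (elim x)
  have "H \<noteq> {}"
    using H.one_closed by blast
  then obtain K L where "cond_uniform_on G \<mu> x K L"
    using elim by (auto simp: cond_subgroup_def split: if_splits)
  then show ?case
    using elim cond_coset_eq[of x K L] by simp
qed

text \<open>The set where the conditional probability of \<open>x 0 = g\<close> vanishes lies in
  \<open>past_algebra\<close>, so integrating over it shows that \<open>x 0 = g\<close> almost never
  happens there. Hence \<open>x 0\<close> lies in the support.\<close>

lemma AE_mem_cond_coset: "AE x in \<mu>. x 0 \<in> cond_coset G \<mu> x"
proof -
  have "AE x in \<mu>. x 0 = g \<longrightarrow> past_prob g x \<noteq> 0" for g
  proof -
    let ?A = "{x \<in> space \<mu>. past_prob g x = 0}"
    have A: "?A \<in> sets past_algebra"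
      using measurable_sets[OF measurable_past_prob, of "{0}" g] by (simp add: vimage_singleton_space)
    have "prob (?A \<inter> {x \<in> space \<mu>. x 0 = g}) = (\<integral>x\<in>?A. past_prob g x \<partial>\<mu>)"
      by (rule set_integral_past_prob[OF A, symmetric])
    also have "\<dots> = (\<integral>x. 0 \<partial>\<mu>)"
      unfolding set_lebesgue_integral_def by (intro Bochner_Integration.integral_cong) (auto simp: indicator_def)
    finally have "prob (?A \<inter> {x \<in> space \<mu>. x 0 = g}) = 0"
      by simp
    moreover have "?A \<inter> {x \<in> space \<mu>. x 0 = g} \<in> sets \<mu>"
      using A subalgebra_past_algebra sets_coordinate_eq by (auto simp: subalgebra_def)
    ultimately have "AE x in \<mu>. x \<notin> ?A \<inter> {x \<in> space \<mu>. x 0 = g}"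
      using prob_eq_0 by blast
    then show ?thesis
      using AE_space by eventually_elim auto
  qed
  then have "AE x in \<mu>. \<forall>g\<in>carrier G. x 0 = g \<longrightarrow> past_prob g x \<noteq> 0"
    by (intro AE_finite_allI finite_carrier)
  moreover have "AE x in \<mu>. \<forall>g\<in>carrier G. 0 \<le> past_prob g x"
    by (intro AE_finite_allI finite_carrier AE_past_prob_nonneg)
  ultimately show ?thesis
    using AE_cond_uniform_on AE_space
  proof eventually_elim
    case (elim x)
    then have "x 0 \<in> carrier G" "0 < past_prob (x 0) x"
      by (auto simp: space_eq less_le)
    then show ?case
      using cond_uniform_on_support[OF elim(3)] by auto
  qed
qed

lemma AE_cond_coset: "AE x in \<mu>. cond_coset G \<mu> x = H #> x 0"
  using AE_mem_cond_coset AE_cond_uniform_on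
proof eventually_elim
  case (elim x)
  then obtain a where "a \<in> carrier G" "cond_coset G \<mu> x = H #> a"
    by (auto simp: cond_uniform_on_def RCOSETS_def)
  then show ?case
    using elim(1) repr_independence[OF _ _ H.is_subgroup] by simp
qed

lemma AE_past_prob: "AE x in \<mu>. \<forall>g\<in>carrier G. past_prob g x = indicator (H #> x 0) g / real (card H)"
proof -
  have "AE x in \<mu>. \<forall>g\<in>carrier G. 0 \<le> past_prob g x"
    by (intro AE_finite_allI finite_carrier AE_past_prob_nonneg)
  then show ?thesis
    using AE_cond_coset AE_cond_uniform_on
  proof eventually_elim
    case (elim x)
    then have u: "H #> x 0 \<in> rcosets H"
      "\<forall>g\<in>carrier G. ennreal (past_prob g x) = ennreal (indicator (H #> x 0) g / real (card (H #> x 0)))"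
      by (simp_all add: cond_uniform_on_iff)
    then show ?case
      using elim(1) card_rcosets_equal[OF u(1) H.subset] by (simp add: ennreal_inj)
  qed
qed

text \<open>The coset is the support of the conditional measure. The sets where
  \<open>past_prob g\<close> is nonzero lie in \<open>past_algebra\<close>, hence are preimages
  under \<open>shift\<close>, and this makes the support a function of
  \<open>shift x\<close>.\<close>

lemma exists_coset_pred: "\<exists>F. simple_function \<mu> F \<and> (AE x in \<mu>. F (shift x) = H #> x 0)"
proof -
  have "\<exists>A\<in>sets \<mu>. {x \<in> space \<mu>. past_prob g x \<noteq> 0} = shift -` A \<inter> space \<mu>" for g
  proof -
    have "past_prob g -` (- {0}) \<inter> space past_algebra \<in> sets past_algebra"
      by (rule measurable_sets[OF measurable_past_prob]) simp
    moreover have "past_prob g -` (- {0}) \<inter> space past_algebra = {x \<in> space \<mu>. past_prob g x \<noteq> 0}"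
      by auto
    ultimately show ?thesis
      unfolding sets_past_algebra by auto
  qed
  then obtain A where A: "\<And>g. A g \<in> sets \<mu>" "\<And>g. {x \<in> space \<mu>. past_prob g x \<noteq> 0} = shift -` A g \<inter> space \<mu>"
    by metis
  define F where "F x = {g \<in> carrier G. x \<in> A g}" for x
  have "F \<in> measurable \<mu> (count_space (Pow (carrier G)))"
  proof -
    have fin: "finite (Pow (carrier G))"
      using finite_carrier by simp
    have "{x \<in> space \<mu>. F x = L} \<in> sets \<mu>" if "L \<subseteq> carrier G" for L
    proof -
      have "{x \<in> space \<mu>. F x = L} = {x \<in> space \<mu>. \<forall>g\<in>carrier G. x \<in> A g \<longleftrightarrow> g \<in> L}"
        using that by (auto simp: F_def)
      also have "\<dots> \<in> sets \<mu>"
      proof (intro sets.sets_Collect_finite_All finite_carrier)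
        fix g
        have "{x \<in> space \<mu>. x \<in> A g \<longleftrightarrow> g \<in> L} = (if g \<in> L then A g else space \<mu> - A g)"
          using sets.sets_into_space[OF A(1)] by auto
        then show "{x \<in> space \<mu>. x \<in> A g \<longleftrightarrow> g \<in> L} \<in> sets \<mu>"
          using A(1) by simp
      qed
      finally show ?thesis .
    qed
    then show ?thesis
      unfolding measurable_count_space_eq2[OF fin] vimage_singleton_space
      by (intro conjI funcsetI ballI) (auto simp: F_def)
  qed
  then have "simple_function \<mu> F"
    using finite_carrier by (intro simple_function_count_spaceI) auto
  moreover have "AE x in \<mu>. F (shift x) = H #> x 0"
    using AE_past_prob AE_space
  proof eventually_elim
    case (elim x)
    have "H #> x 0 \<subseteq> carrier G"
      using elim(2) r_coset_subset_G[OF H.subset] by (simp add: space_eq)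
    moreover have "shift x \<in> A g \<longleftrightarrow> past_prob g x \<noteq> 0" for g
      using A(2)[of g] elim(2) by blast
    ultimately show ?case
      using elim(1) card_H_pos by (auto simp: F_def indicator_def split: if_splits)
  qed
  ultimately show ?thesis
    by blast
qed

text \<open>Since \<open>g\<close> and \<open>h \<otimes> g\<close> lie in the same right coset of
  \<open>H\<close>, they almost surely have equal conditional probabilities, which are then
  integrated over \<open>A\<close>.\<close>

lemma prob_coordinate_left_mult:
  assumes h: "h \<in> H" and g: "g \<in> carrier G" and A: "A \<in> sets past_algebra"
  shows "prob (A \<inter> {x \<in> space \<mu>. x 0 = h \<otimes> g}) = prob (A \<inter> {x \<in> space \<mu>. x 0 = g})"
proof -
  have "A \<in> sets \<mu>"
    using A subalgebra_past_algebra by (auto simp: subalgebra_def)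
  have "AE x in \<mu>. past_prob (h \<otimes> g) x = past_prob g x"
    using AE_past_prob AE_space
  proof eventually_elim
    case (elim x)
    have "h \<otimes> g \<in> H #> x 0 \<longleftrightarrow> g \<in> H #> x 0"
    proof
      assume "g \<in> H #> x 0"
      then show "h \<otimes> g \<in> H #> x 0"
        using h elim(2) by (auto simp: r_coset_def space_eq H_carrier m_assoc[symmetric] intro!: bexI)
    next
      assume "h \<otimes> g \<in> H #> x 0"
      then obtain k where k: "k \<in> H" "h \<otimes> g = k \<otimes> x 0"
        by (auto simp: r_coset_def)
      have "g = inv h \<otimes> (h \<otimes> g)"
        using h g by (simp add: H_carrier m_assoc[symmetric])
      also have "\<dots> = (inv h \<otimes> k) \<otimes> x 0"
        using k h elim(2) by (simp add: H_carrier m_assoc space_eq)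
      finally have "g = (inv h \<otimes> k) \<otimes> x 0" .
      moreover have "inv h \<otimes> k \<in> H"
        using h k(1) by simp
      ultimately show "g \<in> H #> x 0"
        by (auto simp: r_coset_def)
    qed
    then show ?case
      using elim(1) g h by (simp add: indicator_def H_carrier)
  qed
  then have "(\<integral>x\<in>A. past_prob (h \<otimes> g) x \<partial>\<mu>) = (\<integral>x\<in>A. past_prob g x \<partial>\<mu>)"
    unfolding set_lebesgue_integral_def using \<open>A \<in> sets \<mu>\<close> measurable_past_prob'
    by (intro integral_cong_AE) (auto elim: AE_mp)
  then show ?thesis
    by (simp add: set_integral_past_prob[OF A])
qed

text \<open>Split \<open>A\<close> by the value \<open>g\<close> of \<open>x 0\<close> into pieces
  with a tail event \<open>B g\<close>. Its preimage splits with \<open>B (h \<otimes> g)\<close> in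
  place of \<open>B g\<close>; \<open>prob_coordinate_left_mult\<close> and reindexing by left
  translation match the pieces.\<close>

lemma left_mult_invariant_cond_subgroup:
  assumes h: "h \<in> H"
  shows "invariant_under \<mu> (left_mult_0 G h)"
proof -
  have T: "left_mult_0 G h \<in> measurable \<mu> \<mu>"
  proof (rule measurable_muI)
    fix i
    show "(\<lambda>x. left_mult_0 G h x i) \<in> measurable \<mu> (count_space (carrier G))"
    proof (cases i)
      case 0
      have "(\<lambda>x. h \<otimes> x 0) \<in> measurable \<mu> (count_space (carrier G))"
        using h by (intro measurable_count_space_simple simple_function_compose1[OF simple_coordinate])
          (auto simp: space_eq H_carrier)
      then show ?thesis
        using 0 by simp
    qed (simp add: measurable_coordinate)
  qed
  have "emeasure (distr \<mu> \<mu> (left_mult_0 G h)) A = emeasure \<mu> A" if A: "A \<in> sets \<mu>" for A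
  proof -
    define B where "B g = shift -` {w \<in> space \<mu>. case_nat g w \<in> A} \<inter> space \<mu>" for g
    let ?S = "\<lambda>g. {x \<in> space \<mu>. x 0 = g}"
    let ?T = "left_mult_0 G h -` A \<inter> space \<mu>"
    have B: "B g \<in> sets past_algebra" if g: "g \<in> carrier G" for g
    proof -
      have "(\<lambda>w. case_nat g w) \<in> measurable \<mu> \<mu>"
      proof (rule measurable_muI)
        fix i
        show "(\<lambda>w. case_nat g w i) \<in> measurable \<mu> (count_space (carrier G))"
          using g by (cases i) (simp_all add: measurable_coordinate)
      qed
      then have "{w \<in> space \<mu>. case_nat g w \<in> A} \<in> sets \<mu>"
        using measurable_sets[OF _ A] by (simp add: vimage_def Int_def conj_commute)
      then show ?thesis
        unfolding B_def sets_past_algebra by blast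
    qed
    have BS: "B g \<inter> ?S k \<in> sets \<mu>" if "g \<in> carrier G" for g k
      using B[OF that] subalgebra_past_algebra sets_coordinate_eq by (auto simp: subalgebra_def)
    have case_eq: "case_nat (x 0) (shift x) = x" for x :: "nat \<Rightarrow> 'a"
      by (auto simp: fun_eq_iff shift_def split: nat.split)
    have x0: "x 0 \<in> carrier G" "shift x \<in> space \<mu>" if "x \<in> space \<mu>" for x
      using that shift_in_space by (auto simp: space_eq)
    have A_Un: "A = (\<Union>g\<in>carrier G. B g \<inter> ?S g)"
      using sets.sets_into_space[OF A] x0 by (auto simp: B_def case_eq)
    have "case_nat (h \<otimes> x 0) (shift x) = left_mult_0 G h x" for x
      using case_eq[of "left_mult_0 G h x"] by simp
    then have T_Un: "?T = (\<Union>g\<in>carrier G. B (h \<otimes> g) \<inter> ?S g)"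
      using x0 by (auto simp: B_def)
    have hg: "h \<otimes> g \<in> carrier G" if "g \<in> carrier G" for g
      using h that by (simp add: H_carrier)
    have "prob ?T = (\<Sum>g\<in>carrier G. prob (B (h \<otimes> g) \<inter> ?S g))"
      unfolding T_Un using BS hg
      by (intro finite_measure_finite_Union finite_carrier) (auto simp: disjoint_family_on_def)
    also have "\<dots> = (\<Sum>g\<in>carrier G. prob (B (h \<otimes> g) \<inter> ?S (h \<otimes> g)))"
      using prob_coordinate_left_mult[OF h _ B[OF hg]] by (intro sum.cong) auto
    also have "\<dots> = (\<Sum>g\<in>carrier G. prob (B g \<inter> ?S g))"
    proof (rule sum.reindex_bij_witness[of _ "\<lambda>g. inv h \<otimes> g" "\<lambda>g. h \<otimes> g"])
      fix g assume "g \<in> carrier G"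
      then show "inv h \<otimes> (h \<otimes> g) = g" "h \<otimes> (inv h \<otimes> g) = g" "h \<otimes> g \<in> carrier G" "inv h \<otimes> g \<in> carrier G"
        using h by (simp_all add: H_carrier m_assoc[symmetric])
    qed simp
    also have "\<dots> = prob (\<Union>g\<in>carrier G. B g \<inter> ?S g)"
      using BS by (intro finite_measure_finite_Union[symmetric] finite_carrier) (auto simp: disjoint_family_on_def)
    also have "\<dots> = prob A"
      by (simp only: A_Un[symmetric])
    finally have "prob ?T = prob A" .
    then show ?thesis
      using A T by (simp add: emeasure_distr emeasure_eq_measure)
  qed
  then have "distr \<mu> \<mu> (left_mult_0 G h) = \<mu>"
    by (intro measure_eqI) simp_all
  then show ?thesis
    using T by (simp add: invariant_under_def)
qed

end

end

section \<open>Entropy of the coset factor\<close>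

theorem proposition5p6:
  fixes G :: "('a, 'b) monoid_scheme" and \<mu> :: "(nat \<Rightarrow> 'a) measure" and H :: "'a set" and C :: nat
  assumes "group G" and "finite (carrier G)"
    and "prob_space \<mu>" and "sets \<mu> = sets (full_shift (carrier G))"
    and "invariant_under \<mu> shift"
    and "invariant_under \<mu> (mult_ca G)"
    and "H \<lhd> G"
    and "AE x in \<mu>. cond_subgroup G \<mu> x = H"
    and "C = Max {card K | K. subgroup K G \<and> K \<subset> H}"
    and "real (order G) / real (card H) < real (card H) / real C"
  shows "measure_entropy (distr \<mu> (full_shift (Pow (carrier G))) (coset_map G \<mu>)) shift = 0"
proof -
  interpret normal_shift_measure G \<mu> H
    by (intro normal_shift_measure.intro normal_shift_measure_axioms.intro) (fact assms)+
  obtain F where F: "simple_function \<mu> F" "AE x in \<mu>. F (shift x) = r_coset G H (x 0)"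
    using exists_coset_pred[OF assms(8)] by blast
  interpret coset_uniform_measure G \<mu> H F
    by (intro coset_uniform_measure.intro coset_uniform_measure_axioms.intro normal_shift_measure_axioms)
      (fact assms(6) F | erule left_mult_invariant_cond_subgroup[OF assms(8)])+
  \<comment> \<open>The quotient in the hypothesis is the index of \<open>H\<close>, which bounds
    the number of values of the homomorphism into the factor group.\<close>
  have order: "real (order G) / real (card H) = real (card (rcosets\<^bsub>G\<^esub> H))"
    using lagrange[OF H.is_subgroup] card_H_pos by (simp add: field_simps flip: of_nat_mult)
  \<comment> \<open>A given \<open>K\<close> makes the set under \<open>Max\<close> nonempty, so
    \<open>C\<close> is positive and the quotient by \<open>C\<close> is genuine. For trivial
    \<open>H\<close> there is no such \<open>K\<close>.\<close>
  have small: "card K * card (rcosets\<^bsub>G\<^esub> H) < card H" if K: "subgroup K G" "K \<subset> H" for K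
  proof -
    have "finite {card K | K. subgroup K G \<and> K \<subset> H}"
      by (rule finite_subset[of _ "card ` Pow H"]) (use finite_H in auto)
    then have "card K \<le> C"
      unfolding assms(9) using K by (intro Max_ge) auto
    moreover have "0 < card K"
      using K finite_subset[of K H] finite_H subgroup.one_closed[OF K(1)] by (auto simp: card_gt_0_iff)
    ultimately have C: "0 < C"
      by linarith
    have "real (card K * card (rcosets\<^bsub>G\<^esub> H)) \<le> real (C * card (rcosets\<^bsub>G\<^esub> H))"
      using \<open>card K \<le> C\<close> by (simp add: mult_right_mono)
    also have "\<dots> < real (card H)"
      using assms(10) C unfolding order by (simp add: field_simps)
    finally show ?thesis
      by (simp only: of_nat_less_iff)
  qed
  let ?N = "full_shift (Pow (carrier G))"
  let ?\<nu> = "distr \<mu> ?N (coset_map G \<mu>)"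
  \<comment> \<open>Shift invariance carries the identification of the coset from index 0 to all of
    the countably many indices at once.\<close>
  have coset_map: "AE x in \<mu>. coset_map G \<mu> x = (\<lambda>i. r_coset G H (x i))"
  proof -
    have "AE x in \<mu>. \<forall>i. cond_coset G \<mu> ((shift ^^ i) x) = r_coset G H ((shift ^^ i) x 0)"
      by (subst AE_all_countable)
        (intro allI AE_invariant_under[OF invariant_under_funpow[OF shift_invariant] AE_cond_coset[OF assms(8)]])
    then show ?thesis
      by eventually_elim (simp add: coset_map_def funpow_shift)
  qed
  have shift_full: "shift \<in> measurable ?N ?N"
    using measurable_full_shift_coordinate by (intro measurable_full_shiftI) (simp add: shift_def)
  have rate: "entropy_rate ?\<nu> shift X = 0" if "simple_function ?\<nu> X" for X
  proof -
    have X: "simple_function ?N X"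
      using that by (simp add: simple_function_def)
    have "partition_entropy ?\<nu> (itinerary shift X n)
        = partition_entropy \<mu> (\<lambda>x. orbit_word shift X n (\<lambda>i. r_coset G H (x i)))" for n
    proof -
      note w = simple_function_orbit_word[OF shift_full X, of n]
      have "simple_function \<mu> (\<lambda>x. orbit_word shift X n (\<lambda>i. r_coset G H (x i)))"
        using simple_function_comp[OF measurable_extended_cosets[of 0] w]
        by (simp add: extended_cosets_def[abs_def])
      moreover have "AE x in \<mu>. orbit_word shift X n (coset_map G \<mu> x)
          = orbit_word shift X n (\<lambda>i. r_coset G H (x i))"
        using coset_map by eventually_elim simp
      ultimately show ?thesis
        unfolding itinerary_eq_orbit_word partition_entropy_distr[OF measurable_coset_map w]
        by (intro partition_entropy_cong_AE simple_function_comp[OF measurable_coset_map w])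
    qed
    then have "(\<lambda>n. partition_entropy ?\<nu> (itinerary shift X n) / real n) \<longlonglongrightarrow> 0"
      using entropy_coset_process_tendsto_0[OF small X] by simp
    then show ?thesis
      unfolding entropy_rate_def by (rule limI)
  qed
  \<comment> \<open>The supremum runs over a nonempty set, since constants are simple
    functions.\<close>
  have "(SUP X\<in>{X. simple_function ?\<nu> X}. ereal (entropy_rate ?\<nu> shift X)) = (SUP X\<in>{X :: (nat \<Rightarrow> 'a set) \<Rightarrow> nat. simple_function ?\<nu> X}. 0)"
    by (intro SUP_cong) (auto simp: rate)
  also have "\<dots> = 0"
    by (intro SUP_const) auto
  finally show ?thesis
    by (simp add: measure_entropy_def)
qed

end
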